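(* Let $q$ be a prime power and $\mathbb{F}=\mathbb{F}_q$. There exist $c>0$ and $n_0$, depending only on $q$, such that for every $n\ge n_0$ divisible by $q$, every integer $d\ge0$ and every polynomial $P\in\mathbb{F}[x_1,\dots,x_n]$ of degree at most $d$ such that $P(\mathbf{a})\ne0$ for some $\mathbf{a}\in\mathbb{F}^n_\mu$, we have $$\Pr_{\mathbf{b}\sim\mathbb{F}^n_\mu}[P(\mathbf{b})\ne0]\ \ge\ \delta(q,d)-\frac{1}{n^{c}},$$ where $\mathbf{b}$ is uniform on $\mathbb{F}^n_\mu$.
   Context: $\mathbb{F}^n_\mu$ denotes the balanced multislice $\{\mathbf{a}\in\mathbb{F}^n:\ |\{i:a_i=\sigma\}|=n/q\ \forall\sigma\in\mathbb{F}\}$. $\delta(q,d)=(1-\beta/q)\,q^{-\alpha}$, where $\alpha$ and $\beta$ are the quotient and remainder when $d$ is divided by $q-1$. *)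

theory Defs
  imports "HOL-Probability.Probability" "HOL-Library.Poly_Mapping"
begin

text \<open>
  Polynomials in variables indexed by \<^typ>\<open>nat\<close> are finitely supported maps from exponent
  vectors to coefficients. The ring \<open>F[x\<^sub>1, \<dots>, x\<^sub>n]\<close> consists of those that only involve
  the variables with index \<open>0, \<dots>, n - 1\<close>.
\<close>

type_synonym 'a mpoly = "(nat \<Rightarrow>\<^sub>0 nat) \<Rightarrow>\<^sub>0 'a"

definition mpoly_ring :: "nat \<Rightarrow> 'a::comm_semiring_1 mpoly set" where
  "mpoly_ring n = {P. \<forall>m \<in> Poly_Mapping.keys P. Poly_Mapping.keys m \<subseteq> {..<n}}"

definition monom_degree :: "(nat \<Rightarrow>\<^sub>0 nat) \<Rightarrow> nat" where
  "monom_degree m = (\<Sum>i \<in> Poly_Mapping.keys m. Poly_Mapping.lookup m i)"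

text \<open>The zero polynomial gets degree \<open>0\<close>.\<close>

definition total_degree :: "'a::comm_semiring_1 mpoly \<Rightarrow> nat" where
  "total_degree P = Max (insert 0 (monom_degree ` Poly_Mapping.keys P))"

definition mpoly_eval :: "'a::comm_semiring_1 mpoly \<Rightarrow> (nat \<Rightarrow> 'a) \<Rightarrow> 'a" where
  "mpoly_eval P a =
     (\<Sum>m \<in> Poly_Mapping.keys P. Poly_Mapping.lookup P m *
        (\<Prod>i \<in> Poly_Mapping.keys m. a i ^ Poly_Mapping.lookup m i))"

text \<open>Points of \<open>F\<^sup>n\<close> are extensional functions on \<open>{..<n}\<close>, so that this set is finite.\<close>

definition balanced_multislice :: "nat \<Rightarrow> (nat \<Rightarrow> 'a::finite) set" where
  "balanced_multislice n =
     {a \<in> {..<n} \<rightarrow>\<^sub>E UNIV. \<forall>\<sigma>. real (card {i \<in> {..<n}. a i = \<sigma>}) = real n / real CARD('a)}"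

definition delta :: "nat \<Rightarrow> nat \<Rightarrow> real" where
  "delta q d =
     (let \<alpha> = d div (q - 1); \<beta> = d mod (q - 1)
      in (1 - real \<beta> / real q) * real q powr (- real \<alpha>))"

end

theory Submission
  imports Defs "HOL-Combinatorics.Permutations"
begin

text \<open>
  Let \<open>\<Omega>\<close> be the balanced multislice, \<open>S\<close> the set of its points where \<open>P\<close> does not vanish, and
  \<open>\<mu>\<close> the density of \<open>S\<close> in \<open>\<Omega>\<close>. If \<open>q\<^bsup>d div (q - 1)\<^esup>\<close> exceeds a small power of \<open>n\<close>, the bound is
  trivial. Otherwise a crude induction on the degree gives \<open>\<mu> \<ge> q\<^bsup>-4d\<^esup>\<close>, again at least a small
  negative power of \<open>n\<close>.

  Embed \<open>F\<^bsup>r\<^esup>\<close>, with \<open>q\<^bsup>r\<^esup>\<close> about \<open>n\<^bsup>1/4\<^esup>\<close>, into \<open>\<Omega>\<close> by a map with affine coordinates in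
  which every affine form occurs equally often, and permute the \<open>n\<close> coordinates at random. The
  pull-back of \<open>P\<close> to \<open>F\<^bsup>r\<^esup>\<close> has degree at most \<open>d\<close>, so it is nonzero on a fraction of at least
  \<open>\<delta>(q, d)\<close> of \<open>F\<^bsup>r\<^esup>\<close> unless it vanishes identically. It remains to see that with high
  probability the embedded copy of \<open>F\<^bsup>r\<^esup>\<close> meets \<open>S\<close>.

  This is a second moment argument. Two distinct points of the embedded copy form a uniformly random
  pair \<open>(x, y)\<close> for which all joint colour classes \<open>{i. x i = \<sigma> \<and> y i = \<tau>}\<close> have (almost) the same
  size, so one needs the operator \<open>T\<close> which averages a function over all such \<open>y\<close> to be small
  on functions of mean zero. The operator \<open>T\<^sup>2\<close> contracts the Lipschitz constant with respect
  to transpositions of coordinates by a factor \<open>O(n\<^bsup>-1/2\<^esup>)\<close>; since \<open>\<Omega>\<close> has diameter at most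
  \<open>n\<close>, the fourth power of \<open>T\<^sup>2\<close> is uniformly small, and Cauchy--Schwarz carries this over to
  \<open>T\<close>.
\<close>

hide_const (open) Finite_Cartesian_Product.transpose

section \<open>Slices\<close>

text \<open>The colour counts may differ, since pinning coordinates destroys balance, and the
  colours may be pairs, so that two points of one slice become a single point of another.\<close>

definition slice :: "'i set \<Rightarrow> ('c \<Rightarrow> nat) \<Rightarrow> ('i \<Rightarrow> 'c) set" where
  "slice I k = {x \<in> I \<rightarrow>\<^sub>E UNIV. \<forall>c. card {i \<in> I. x i = c} = k c}"

lemma finite_slice: "finite I \<Longrightarrow> finite (slice I (k :: 'c::finite \<Rightarrow> nat))"
  by (rule finite_subset[of _ "I \<rightarrow>\<^sub>E UNIV"]) (auto simp: slice_def intro: finite_PiE)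

lemma card_Collect_permutes:
  assumes "p permutes I"
  shows "card {i \<in> I. Q (p i)} = card {i \<in> I. Q i}"
proof (rule bij_betw_same_card)
  show "bij_betw p {i \<in> I. Q (p i)} {i \<in> I. Q i}"
    unfolding bij_betw_def
  proof
    show "inj_on p {i \<in> I. Q (p i)}"
      using permutes_inj[OF assms] by (auto simp: inj_on_def)
    show "p ` {i \<in> I. Q (p i)} = {i \<in> I. Q i}"
    proof
      show "{i \<in> I. Q i} \<subseteq> p ` {i \<in> I. Q (p i)}"
      proof
        fix i assume i: "i \<in> {i \<in> I. Q i}"
        then have "inv p i \<in> I" using assms by (metis (mono_tags) mem_Collect_eq permutes_in_image permutes_inv)
        moreover have "p (inv p i) = i" using assms by (simp add: permutes_inverses(1))
        ultimately show "i \<in> p ` {i \<in> I. Q (p i)}"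
          using i by (metis (mono_tags, lifting) image_eqI mem_Collect_eq)
      qed
    qed (use assms in \<open>auto simp: permutes_in_image\<close>)
  qed
qed

lemma PiE_comp_permutes:
  assumes "p permutes I" "x \<in> I \<rightarrow>\<^sub>E UNIV"
  shows "x \<circ> p \<in> I \<rightarrow>\<^sub>E UNIV"
  using assms by (auto simp: PiE_def extensional_def permutes_not_in)

lemma slice_comp_permutes:
  assumes "p permutes I" "x \<in> slice I k"
  shows "x \<circ> p \<in> slice I k"
  using assms PiE_comp_permutes[of p I x] card_Collect_permutes[OF assms(1), of "\<lambda>i. x i = _"]
  by (auto simp: slice_def)

section \<open>Moving between points of a slice by transpositions\<close>

lemma comp_transpose_involutory: "(x \<circ> transpose i j) \<circ> transpose i j = x"
  by (auto simp: fun_eq_iff)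

lemma comp_transpose_same: "x i = x j \<Longrightarrow> x \<circ> transpose i j = x"
  by (auto simp: fun_eq_iff Transposition.transpose_def)

lemma slice_transpose:
  "i \<in> I \<Longrightarrow> j \<in> I \<Longrightarrow> x \<in> slice I k \<Longrightarrow> x \<circ> transpose i j \<in> slice I k"
  by (rule slice_comp_permutes) (auto intro: permutes_swap_id)

text \<open>If \<open>x\<close> and \<open>y\<close> differ at \<open>i\<close>, equal counts force
  the colour \<open>y i\<close> to occur in \<open>x\<close> at some \<open>j\<close> where
  \<open>y\<close> has another colour. Exchanging \<open>i\<close> and \<open>j\<close> repairs
  \<open>i\<close>, and \<open>j\<close> was wrong already.\<close>

lemma slice_swap_closer:
  assumes "finite I" "x \<in> slice I k" "y \<in> slice I k" "x \<noteq> y"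
  obtains i j where "i \<in> I" "j \<in> I"
    "card {u \<in> I. (x \<circ> transpose i j) u \<noteq> y u} < card {u \<in> I. x u \<noteq> y u}"
proof -
  obtain i where i: "i \<in> I" "x i \<noteq> y i"
    using assms by (auto simp: slice_def fun_eq_iff PiE_def extensional_def) metis
  have "\<exists>j\<in>I. x j = y i \<and> y j \<noteq> y i"
  proof (rule ccontr)
    assume "\<not> ?thesis"
    then have "{u \<in> I. x u = y i} \<subset> {u \<in> I. y u = y i}" using i by auto
    then have "card {u \<in> I. x u = y i} < card {u \<in> I. y u = y i}"
      using assms(1) by (intro psubset_card_mono) auto
    then show False using assms(2,3) by (auto simp: slice_def)
  qed
  then obtain j where j: "j \<in> I" "x j = y i" "y j \<noteq> y i" by blast
  have "{u \<in> I. (x \<circ> transpose i j) u \<noteq> y u} \<subseteq> {u \<in> I. x u \<noteq> y u} - {i}"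
    using i j by (auto simp: Transposition.transpose_def split: if_splits)
  also have "\<dots> \<subset> {u \<in> I. x u \<noteq> y u}" using i by auto
  finally have "card {u \<in> I. (x \<circ> transpose i j) u \<noteq> y u} < card {u \<in> I. x u \<noteq> y u}"
    using assms(1) by (intro psubset_card_mono) auto
  then show ?thesis using that i j by blast
qed

text \<open>By \<open>slice_swap_closer\<close>, transpositions lead from \<open>x\<close> to
  \<open>y\<close> in at most as many steps as there are coordinates where they differ, and each
  step costs at most \<open>L\<close>.\<close>

lemma slice_Lipschitz:
  fixes f :: "('i \<Rightarrow> 'c) \<Rightarrow> real"
  assumes "finite I"
    and lip: "\<And>x i j. x \<in> slice I k \<Longrightarrow> i \<in> I \<Longrightarrow> j \<in> I \<Longrightarrow> \<bar>f x - f (x \<circ> transpose i j)\<bar> \<le> L"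
    and "L \<ge> 0" "x \<in> slice I k" "y \<in> slice I k"
  shows "\<bar>f x - f y\<bar> \<le> real (card I) * L"
proof -
  have "\<bar>f x - f y\<bar> \<le> real (card {u \<in> I. x u \<noteq> y u}) * L"
    using \<open>x \<in> slice I k\<close>
  proof (induction "card {u \<in> I. x u \<noteq> y u}" arbitrary: x rule: less_induct)
    case less
    show ?case
    proof (cases "x = y")
      case False
      obtain i j where ij: "i \<in> I" "j \<in> I"
          and cl: "card {u \<in> I. (x \<circ> transpose i j) u \<noteq> y u} < card {u \<in> I. x u \<noteq> y u}"
        using slice_swap_closer[OF assms(1) less.prems \<open>y \<in> slice I k\<close> False] by blast
      define z where "z = x \<circ> transpose i j"
      have "\<bar>f z - f y\<bar> \<le> real (card {u \<in> I. z u \<noteq> y u}) * L"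
        using less.hyps[of z] cl slice_transpose[OF ij less.prems] by (simp add: z_def)
      moreover have "\<bar>f x - f z\<bar> \<le> L" using lip[OF less.prems ij] by (simp add: z_def)
      ultimately have "\<bar>f x - f y\<bar> \<le> (real (card {u \<in> I. z u \<noteq> y u}) + 1) * L"
        by (simp add: algebra_simps)
      also have "\<dots> \<le> real (card {u \<in> I. x u \<noteq> y u}) * L"
        using cl \<open>L \<ge> 0\<close> by (intro mult_right_mono) (auto simp: z_def)
      finally show ?thesis .
    qed auto
  qed
  also have "\<dots> \<le> real (card I) * L"
    using assms(1,3) by (intro mult_right_mono) (auto intro: card_mono)
  finally show ?thesis .
qed

text \<open>The case \<open>L = 0\<close> of the Lipschitz bound: transpositions connect the whole
  slice.\<close>

lemma slice_invariant:
  fixes f :: "('i \<Rightarrow> 'c) \<Rightarrow> real"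
  assumes "finite I"
    and "\<And>x i j. x \<in> slice I k \<Longrightarrow> i \<in> I \<Longrightarrow> j \<in> I \<Longrightarrow> f (x \<circ> transpose i j) = f x"
    and "x \<in> slice I k" "y \<in> slice I k"
  shows "f x = f y"
proof -
  have "\<bar>f x - f y\<bar> \<le> real (card I) * 0"
  proof (rule slice_Lipschitz[OF assms(1) _ _ assms(3,4)])
    show "\<bar>f z - f (z \<circ> transpose i j)\<bar> \<le> 0" if "z \<in> slice I k" "i \<in> I" "j \<in> I" for z i j
      unfolding assms(2)[OF that] by simp
  qed simp
  then show ?thesis by simp
qed

section \<open>Averages over all permutations of the coordinates\<close>

lemma sum_comp_permutes:
  assumes p: "p permutes I" and inv: "\<And>q x. q permutes I \<Longrightarrow> x \<in> X \<Longrightarrow> x \<circ> q \<in> X"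
  shows "(\<Sum>x\<in>X. f (x \<circ> p)) = (\<Sum>x\<in>X. f x)"
proof (rule sum.reindex_bij_witness[where j = "\<lambda>x. x \<circ> p" and i = "\<lambda>x. x \<circ> inv p"])
  show "x \<circ> p \<circ> inv p = x" "x \<circ> inv p \<circ> p = x" for x :: "'a \<Rightarrow> 'b"
    using permutes_inverses[OF p] by (simp_all add: fun_eq_iff)
qed (auto intro!: inv p permutes_inv[OF p])

text \<open>A uniform permutation of the coordinates sends any \<open>x\<close> to a uniform point
  of its slice: the left side is unchanged when \<open>x\<close> is transposed, so it equals its
  average over the slice.\<close>

lemma sum_permutes_slice:
  fixes f :: "('i \<Rightarrow> 'c::finite) \<Rightarrow> real"
  assumes I: "finite I" and x: "x \<in> slice I k"
  shows "(\<Sum>p | p permutes I. f (x \<circ> p)) = fact (card I) * (\<Sum>y\<in>slice I k. f y) / card (slice I k)"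
proof -
  define F where "F x = (\<Sum>p | p permutes I. f (x \<circ> p))" for x :: "'i \<Rightarrow> 'c"
  have "F (y \<circ> transpose i j) = F y" if "i \<in> I" "j \<in> I" for y i j
  proof -
    have t: "transpose i j permutes I" using that by (intro permutes_swap_id)
    show ?thesis unfolding F_def
      by (rule sum.reindex_bij_witness[where j = "\<lambda>p. transpose i j \<circ> p" and i = "\<lambda>p. transpose i j \<circ> p"])
        (use t in \<open>auto simp: comp_assoc[symmetric] intro: permutes_compose\<close>)
  qed
  then have "F y = F x" if "y \<in> slice I k" for y
    using slice_invariant[OF I, of k F y x] that x by blast
  then have "real (card (slice I k)) * F x = (\<Sum>y\<in>slice I k. F y)" by simp
  also have "\<dots> = (\<Sum>p | p permutes I. \<Sum>y\<in>slice I k. f (y \<circ> p))"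
    unfolding F_def by (rule sum.swap)
  also have "\<dots> = (\<Sum>p | p permutes I. \<Sum>y\<in>slice I k. f y)"
    by (intro sum.cong refl sum_comp_permutes[where I = I]) (auto intro: slice_comp_permutes)
  also have "\<dots> = fact (card I) * (\<Sum>y\<in>slice I k. f y)"
    using I by (simp add: card_permutations)
  finally have "real (card (slice I k)) * F x = fact (card I) * (\<Sum>y\<in>slice I k. f y)" .
  moreover have "card (slice I k) \<noteq> 0" using finite_slice[OF I] x by (auto simp: card_eq_0_iff)
  ultimately show ?thesis by (simp add: F_def field_simps)
qed

section \<open>Random walk along pairs of a given type\<close>

text \<open>\<open>m\<close> is the size of every colour class and \<open>t\<close> the table of
  joint class sizes of a pair. In a walk of two steps,
  \<open>t \<sigma> \<tau> * t \<tau> \<upsilon> / m\<close> is the mean size of a triple colour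
  class; \<open>v\<close> is its common approximate value and \<open>\<kappa>\<close> the
  error.\<close>

locale pair_type =
  fixes I :: "'i set" and t :: "'c::finite \<Rightarrow> 'c \<Rightarrow> nat" and m :: nat and v \<kappa> q :: real
  assumes finite_I: "finite I"
    and t_sym: "t \<sigma> \<tau> = t \<tau> \<sigma>"
    and t_row: "(\<Sum>\<tau>\<in>UNIV. t \<sigma> \<tau>) = m"
    and m_pos: "m > 0"
    and q_eq: "q = real CARD('c)"
    and t_product: "\<bar>real (t \<sigma> \<tau>) * real (t \<tau> \<upsilon>) / real m - v\<bar> \<le> \<kappa>"
begin

section \<open>The regular graph formed by the pairs of type \<open>t\<close>\<close>

abbreviation \<Omega> :: "('i \<Rightarrow> 'c) set" where "\<Omega> \<equiv> slice I (\<lambda>_. m)"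

definition adj :: "('i \<Rightarrow> 'c) \<Rightarrow> ('i \<Rightarrow> 'c) \<Rightarrow> bool" where
  "adj x y \<longleftrightarrow> x \<in> I \<rightarrow>\<^sub>E UNIV \<and> y \<in> I \<rightarrow>\<^sub>E UNIV \<and> (\<forall>\<sigma> \<tau>. card {i \<in> I. x i = \<sigma> \<and> y i = \<tau>} = t \<sigma> \<tau>)"

definition nbr :: "('i \<Rightarrow> 'c) \<Rightarrow> ('i \<Rightarrow> 'c) set" where "nbr x = {y. adj x y}"

lemma adj_sym: "adj x y \<Longrightarrow> adj y x"
  unfolding adj_def by (subst t_sym) (simp add: conj_commute)

lemma adj_sliceD: assumes "adj x y" shows "x \<in> \<Omega>"
proof -
  have "card {i \<in> I. x i = \<sigma>} = m" for \<sigma>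
  proof -
    have "{i \<in> I. x i = \<sigma>} = (\<Union>\<tau>\<in>UNIV. {i \<in> I. x i = \<sigma> \<and> y i = \<tau>})" by auto
    also have "card \<dots> = (\<Sum>\<tau>\<in>UNIV. card {i \<in> I. x i = \<sigma> \<and> y i = \<tau>})"
      by (intro card_UN_disjoint) (use finite_I in auto)
    also have "\<dots> = m" using assms t_row by (simp add: adj_def)
    finally show ?thesis .
  qed
  then show ?thesis using assms by (auto simp: slice_def adj_def)
qed

lemma adj_permutes:
  assumes "p permutes I" "adj x y"
  shows "adj (x \<circ> p) (y \<circ> p)"
proof -
  have "card {i \<in> I. (x \<circ> p) i = \<sigma> \<and> (y \<circ> p) i = \<tau>} = t \<sigma> \<tau>" for \<sigma> \<tau>
    using card_Collect_permutes[OF assms(1), of "\<lambda>i. x i = \<sigma> \<and> y i = \<tau>"] assms(2) by (simp add: adj_def)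
  then show ?thesis
    using assms PiE_comp_permutes[OF assms(1), of x] PiE_comp_permutes[OF assms(1), of y]
    unfolding adj_def by blast
qed

lemma adj_transpose:
  assumes "i \<in> I" "j \<in> I"
  shows "adj (x \<circ> transpose i j) y \<longleftrightarrow> adj x (y \<circ> transpose i j)"
proof
  have p: "transpose i j permutes I" using assms by (rule permutes_swap_id)
  show "adj x (y \<circ> transpose i j)" if "adj (x \<circ> transpose i j) y"
    using adj_permutes[OF p that] unfolding comp_transpose_involutory .
  show "adj (x \<circ> transpose i j) y" if "adj x (y \<circ> transpose i j)"
    using adj_permutes[OF p that] unfolding comp_transpose_involutory .
qed

lemma nbr_subset: "nbr x \<subseteq> \<Omega>"
  using adj_sliceD adj_sym by (auto simp: nbr_def)

lemma finite_\<Omega>: "finite \<Omega>"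
  by (rule finite_slice[OF finite_I])

lemma finite_nbr: "finite (nbr x)"
  using nbr_subset finite_\<Omega> finite_subset by blast

lemma nbr_sym: "y \<in> nbr x \<longleftrightarrow> x \<in> nbr y"
  using adj_sym by (auto simp: nbr_def)

lemma nbr_transpose_iff:
  "i \<in> I \<Longrightarrow> j \<in> I \<Longrightarrow> y \<in> nbr (x \<circ> transpose i j) \<longleftrightarrow> y \<circ> transpose i j \<in> nbr x"
  unfolding nbr_def mem_Collect_eq by (rule adj_transpose)

lemma card_nbr_transpose:
  assumes "i \<in> I" "j \<in> I"
  shows "card (nbr (x \<circ> transpose i j)) = card (nbr x)"
proof (rule bij_betw_same_card[of "\<lambda>y. y \<circ> transpose i j"],
    rule bij_betw_byWitness[where f' = "\<lambda>y. y \<circ> transpose i j"])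
  let ?s = "\<lambda>y :: 'i \<Rightarrow> 'c. y \<circ> transpose i j"
  show "\<forall>y\<in>nbr (?s x). ?s (?s y) = y" "\<forall>y\<in>nbr x. ?s (?s y) = y"
    by (intro ballI comp_transpose_involutory)+
  show "?s ` nbr (?s x) \<subseteq> nbr x" using nbr_transpose_iff[OF assms] by blast
  show "?s ` nbr x \<subseteq> nbr (?s x)"
  proof (rule image_subsetI)
    fix y assume "y \<in> nbr x"
    then show "?s y \<in> nbr (?s x)"
      unfolding nbr_transpose_iff[OF assms] comp_transpose_involutory .
  qed
qed

text \<open>All points of \<open>\<Omega>\<close> have equally many neighbours, by transposition
  symmetry, so any chosen point gives the degree of the graph.\<close>

definition deg :: real where "deg = real (card (nbr (SOME x. x \<in> \<Omega>)))"

lemma card_nbr: assumes "x \<in> \<Omega>" shows "real (card (nbr x)) = deg"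
  unfolding deg_def
proof (rule slice_invariant[OF finite_I, where f = "\<lambda>x. real (card (nbr x))" and k = "\<lambda>_. m"])
  show "(SOME x. x \<in> \<Omega>) \<in> \<Omega>" using assms by (metis someI)
  show "real (card (nbr (y \<circ> transpose i j))) = real (card (nbr y))" if "i \<in> I" "j \<in> I" for y i j
    using that by (simp only: card_nbr_transpose)
qed (rule assms)

lemma sum_nbr_swap: "(\<Sum>x\<in>\<Omega>. \<Sum>y\<in>nbr x. f x y) = (\<Sum>y\<in>\<Omega>. \<Sum>x\<in>nbr y. (f x y :: real))"
proof -
  have "(\<Sum>x\<in>\<Omega>. \<Sum>y\<in>nbr x. f x y) = (\<Sum>x\<in>\<Omega>. \<Sum>y | y \<in> \<Omega> \<and> y \<in> nbr x. f x y)"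
    using nbr_subset by (intro sum.cong refl) auto
  also have "\<dots> = (\<Sum>y\<in>\<Omega>. \<Sum>x | x \<in> \<Omega> \<and> y \<in> nbr x. f x y)"
    by (rule sum.swap_restrict[OF finite_\<Omega> finite_\<Omega>])
  also have "\<dots> = (\<Sum>y\<in>\<Omega>. \<Sum>x\<in>nbr y. f x y)"
    using nbr_subset nbr_sym by (intro sum.cong refl) auto
  finally show ?thesis .
qed

text \<open>Both sides run over the walks \<open>x\<close>, \<open>y\<close>, \<open>z\<close> of
  length two starting at \<open>x\<close>.\<close>

lemma sum_nbr_common:
  assumes "x \<in> \<Omega>"
  shows "(\<Sum>z\<in>\<Omega>. \<Sum>y\<in>nbr x \<inter> nbr z. f y z) = (\<Sum>y\<in>nbr x. \<Sum>z\<in>nbr y. (f y z :: real))"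
proof -
  have "(\<Sum>z\<in>\<Omega>. \<Sum>y\<in>nbr x \<inter> nbr z. f y z) = (\<Sum>z\<in>\<Omega>. \<Sum>y | y \<in> nbr x \<and> z \<in> nbr y. f y z)"
    using nbr_sym by (intro sum.cong refl) auto
  also have "\<dots> = (\<Sum>y\<in>nbr x. \<Sum>z | z \<in> \<Omega> \<and> z \<in> nbr y. f y z)"
    by (rule sum.swap_restrict[OF finite_\<Omega> finite_nbr])
  also have "\<dots> = (\<Sum>y\<in>nbr x. \<Sum>z\<in>nbr y. f y z)"
    using nbr_subset by (intro sum.cong refl) auto
  finally show ?thesis .
qed

text \<open>A pair of points is one point with colours in \<open>'c \<times> 'c\<close>, and the
  pairs of type \<open>t\<close> form a slice for these colours, so
  \<open>sum_permutes_slice\<close> applies to pairs.\<close>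

lemma sum_permutes_adj:
  assumes "adj x y"
  shows "(\<Sum>p | p permutes I. f (x \<circ> p) * g (y \<circ> p))
    = fact (card I) * (\<Sum>x\<in>\<Omega>. \<Sum>y\<in>nbr x. f x * g y) / (card \<Omega> * deg)"
proof -
  \<comment> \<open>\<open>zp\<close> merges a pair of colourings into one colouring by pairs;
    \<open>uz\<close> splits it again. The restrictions keep both extensional on
    \<open>I\<close>.\<close>
  define zp where "zp = (\<lambda>(x::'i\<Rightarrow>'c, y::'i\<Rightarrow>'c). \<lambda>i\<in>I. (x i, y i))"
  define uz where "uz = (\<lambda>z :: 'i \<Rightarrow> 'c \<times> 'c. (restrict (fst \<circ> z) I, restrict (snd \<circ> z) I))"
  define k where "k = (\<lambda>(\<sigma>, \<tau>). t \<sigma> \<tau>)"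
  have restr: "restrict h I = h" if "h \<in> I \<rightarrow>\<^sub>E UNIV" for h :: "'i \<Rightarrow> 'c"
    using that by (simp add: PiE_restrict)
  have uz_zp: "uz (zp (x, y)) = (x, y)" if "adj x y" for x y
  proof -
    have "restrict (fst \<circ> zp (x, y)) I = restrict x I" "restrict (snd \<circ> zp (x, y)) I = restrict y I"
      by (rule ext, simp add: zp_def)+
    moreover have "restrict x I = x" "restrict y I = y"
      using that by (auto intro!: restr simp: adj_def)
    ultimately show ?thesis by (simp add: uz_def)
  qed
  have cardeq: "{i \<in> I. zp (x, y) i = (\<sigma>, \<tau>)} = {i \<in> I. x i = \<sigma> \<and> y i = \<tau>}" for x y \<sigma> \<tau>
    by (auto simp: zp_def)
  have zp_in: "zp (x, y) \<in> slice I k" if "adj x y" for x y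
    using that by (auto simp: slice_def k_def adj_def cardeq) (auto simp: zp_def)
  have zp_uz: "zp (uz z) = z" if "z \<in> slice I k" for z
    using that by (auto simp: slice_def zp_def uz_def fun_eq_iff PiE_def extensional_def restrict_def)
  have uz_in: "adj (fst (uz z)) (snd (uz z))" if z: "z \<in> slice I k" for z
  proof -
    have "{i \<in> I. z i = (\<sigma>, \<tau>)} = {i \<in> I. fst (uz z) i = \<sigma> \<and> snd (uz z) i = \<tau>}" for \<sigma> \<tau>
      by (auto simp: uz_def)
    moreover have "card {i \<in> I. z i = (\<sigma>, \<tau>)} = t \<sigma> \<tau>" for \<sigma> \<tau>
      using z by (simp add: slice_def k_def)
    moreover have "fst (uz z) \<in> I \<rightarrow>\<^sub>E UNIV" "snd (uz z) \<in> I \<rightarrow>\<^sub>E UNIV" by (auto simp: uz_def)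
    ultimately show ?thesis unfolding adj_def by presburger
  qed
  have comp: "uz (zp (x, y) \<circ> p) = (x \<circ> p, y \<circ> p)" if "p permutes I" for p
  proof -
    have *: "restrict (fst \<circ> (zp (x, y) \<circ> p)) I = restrict (x \<circ> p) I"
      "restrict (snd \<circ> (zp (x, y) \<circ> p)) I = restrict (y \<circ> p) I"
      using that by (auto simp: zp_def fun_eq_iff restrict_def permutes_in_image)
    moreover have "restrict (x \<circ> p) I = x \<circ> p" "restrict (y \<circ> p) I = y \<circ> p"
      using adj_permutes[OF that assms] by (auto intro!: restr simp: adj_def)
    ultimately show ?thesis by (simp add: uz_def)
  qed
  define F where "F z = f (fst (uz z)) * g (snd (uz z))" for z
  have bij: "bij_betw zp (SIGMA x:\<Omega>. nbr x) (slice I k)"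
  proof (rule bij_betw_byWitness[where f' = uz])
    show "\<forall>xy\<in>(SIGMA x:\<Omega>. nbr x). uz (zp xy) = xy" using uz_zp by (auto simp: nbr_def)
    show "\<forall>z\<in>slice I k. zp (uz z) = z" using zp_uz by blast
    show "zp ` (SIGMA x:\<Omega>. nbr x) \<subseteq> slice I k" using zp_in by (auto simp: nbr_def)
    show "uz ` slice I k \<subseteq> (SIGMA x:\<Omega>. nbr x)"
    proof
      fix xy assume "xy \<in> uz ` slice I k"
      then have "adj (fst xy) (snd xy)" using uz_in by auto
      then show "xy \<in> (SIGMA x:\<Omega>. nbr x)"
        using adj_sliceD[of "fst xy" "snd xy"] by (simp add: nbr_def mem_Sigma_iff[of "fst xy" "snd xy", simplified])
    qed
  qed
  have S: "(\<Sum>z\<in>slice I k. G (uz z)) = (\<Sum>x\<in>\<Omega>. \<Sum>y\<in>nbr x. G (x, y))" for G :: "_ \<Rightarrow> real"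
  proof -
    have "(\<Sum>z\<in>slice I k. G (uz z)) = (\<Sum>xy\<in>(SIGMA x:\<Omega>. nbr x). G (uz (zp xy)))"
      by (rule sum.reindex_bij_betw[OF bij, symmetric])
    also have "\<dots> = (\<Sum>xy\<in>(SIGMA x:\<Omega>. nbr x). G xy)"
      using uz_zp by (intro sum.cong refl arg_cong[of _ _ G]) (auto simp: nbr_def)
    also have "\<dots> = (\<Sum>x\<in>\<Omega>. \<Sum>y\<in>nbr x. G (x, y))"
      using finite_\<Omega> finite_nbr by (subst sum.Sigma) auto
    finally show ?thesis .
  qed
  have "(\<Sum>p | p permutes I. f (x \<circ> p) * g (y \<circ> p)) = (\<Sum>p | p permutes I. F (zp (x, y) \<circ> p))"
    using comp by (intro sum.cong refl) (simp add: F_def)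
  also have "\<dots> = fact (card I) * (\<Sum>z\<in>slice I k. F z) / card (slice I k)"
    by (rule sum_permutes_slice[OF finite_I zp_in[OF assms]])
  also have "(\<Sum>z\<in>slice I k. F z) = (\<Sum>x\<in>\<Omega>. \<Sum>y\<in>nbr x. f x * g y)"
    using S[of "\<lambda>(x, y). f x * g y"] by (simp add: F_def case_prod_beta)
  also have "real (card (slice I k)) = card \<Omega> * deg"
    using S[of "\<lambda>_. 1"] card_nbr by simp
  finally show ?thesis .
qed

section \<open>Concentration of triple colour counts\<close>

text \<open>
  Exchangeability makes the centred indicators negatively correlated, as their sum over a class
  vanishes.
\<close>

lemma count_variance:
  assumes y: "y \<in> \<Omega>" and A: "A \<subseteq> {u \<in> I. y u = b}"
  shows "(\<Sum>z\<in>nbr y. (real (card {u \<in> A. z u = e}) - real (card A) * real (t b e) / m)\<^sup>2) \<le> deg * card A"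
proof -
  define B where "B = {u \<in> I. y u = b}"
  have finB: "finite B" using finite_I by (simp add: B_def)
  have finA: "finite A" using A finB finite_subset by (auto simp: B_def)
  have cardB: "card B = m" using y by (simp add: B_def slice_def)
  \<comment> \<open>\<open>\<zeta>\<close> is the indicator of colour \<open>e\<close> minus its
    mean over the class \<open>B\<close>; \<open>K u w\<close> is the covariance of two coordinates
    up to the factor \<open>deg\<close>.\<close>
  define \<zeta> where "\<zeta> z u = of_bool (z u = e) - real (t b e) / m" for z :: "'i \<Rightarrow> 'c" and u
  define K where "K u w = (\<Sum>z\<in>nbr y. \<zeta> z u * \<zeta> z w)" for u w
  have sumA: "(\<Sum>u\<in>A. \<zeta> z u) = real (card {u \<in> A. z u = e}) - real (card A) * real (t b e) / m" 
    if "finite A" for z A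
    using that by (simp add: \<zeta>_def sum_subtractf of_bool_def sum.If_cases Int_def)
  have sumB: "(\<Sum>u\<in>B. \<zeta> z u) = 0" if "z \<in> nbr y" for z
  proof -
    have "{u \<in> B. z u = e} = {i \<in> I. y i = b \<and> z i = e}" by (auto simp: B_def)
    then have "card {u \<in> B. z u = e} = t b e" using that by (auto simp: nbr_def adj_def)
    then show ?thesis using sumA[OF finB, of z] cardB m_pos by simp
  qed
  have K_swap: "K u w = K u' w" if "u \<in> B" "u' \<in> B" "u \<noteq> w" "u' \<noteq> w" for u u' w
  proof -
    have "u \<in> I" "u' \<in> I" "y u = y u'" using that by (auto simp: B_def)
    then have inv: "z \<circ> transpose u u' \<in> nbr y \<longleftrightarrow> z \<in> nbr y" for z
      using nbr_transpose_iff[of u u' z y] comp_transpose_same[of y u u'] by metis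
    show ?thesis unfolding K_def
      by (rule sum.reindex_bij_witness[where i = "\<lambda>z. z \<circ> transpose u u'" and j = "\<lambda>z. z \<circ> transpose u u'"])
        (use inv that in \<open>auto simp: comp_transpose_involutory \<zeta>_def\<close>)
  qed
  have K_nonneg: "K w w \<ge> 0" for w by (auto simp: K_def intro!: sum_nonneg)
  have K_neg: "K u w \<le> 0" if "u \<in> B" "w \<in> B" "u \<noteq> w" for u w
  proof -
    have "(\<Sum>u'\<in>B. K u' w) = (\<Sum>z\<in>nbr y. (\<Sum>u'\<in>B. \<zeta> z u') * \<zeta> z w)"
      unfolding K_def by (subst sum.swap) (simp add: sum_distrib_right)
    also have "\<dots> = 0" using sumB by simp
    finally have "0 = K w w + (\<Sum>u'\<in>B - {w}. K u' w)"
      using that finB sum.remove[of B w "\<lambda>u'. K u' w"] by linarith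
    \<comment> \<open>All these terms agree by \<open>K_swap\<close>, so the nonnegative
      \<open>K w w\<close> forces their common value to be at most 0.\<close>
    also have "(\<Sum>u'\<in>B - {w}. K u' w) = (\<Sum>u'\<in>B - {w}. K u w)"
      by (intro sum.cong refl K_swap) (use that in auto)
    also have "\<dots> = real (card (B - {w})) * K u w" by simp
    finally have "real (card (B - {w})) * K u w \<le> 0" using K_nonneg[of w] by linarith
    moreover have "card (B - {w}) > 0" using that finB by (subst card_gt_0_iff) auto
    ultimately show ?thesis by (simp add: mult_le_0_iff)
  qed
  have K_diag: "K u u \<le> deg" for u
  proof -
    have "t b e \<le> m" using t_row[of b] member_le_sum[of e UNIV "t b"] by auto
    then have r: "0 \<le> real (t b e) / m" "real (t b e) / m \<le> 1" using m_pos by auto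
    have "\<zeta> z u * \<zeta> z u \<le> 1" for z
    proof -
      have "\<bar>\<zeta> z u\<bar> \<le> 1" using r by (auto simp: \<zeta>_def of_bool_def)
      then show ?thesis using abs_square_le_1[of "\<zeta> z u"] by (simp add: power2_eq_square)
    qed
    then have "K u u \<le> (\<Sum>z\<in>nbr y. 1)" unfolding K_def by (intro sum_mono)
    then show ?thesis using card_nbr[OF y] by simp
  qed
  have "(\<Sum>z\<in>nbr y. (real (card {u \<in> A. z u = e}) - real (card A) * real (t b e) / m)\<^sup>2)
      = (\<Sum>z\<in>nbr y. (\<Sum>u\<in>A. \<zeta> z u)\<^sup>2)"
    using sumA[OF finA] by simp
  also have "\<dots> = (\<Sum>z\<in>nbr y. \<Sum>u\<in>A. \<Sum>w\<in>A. \<zeta> z u * \<zeta> z w)"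
    by (simp add: power2_eq_square sum_product)
  also have "\<dots> = (\<Sum>u\<in>A. \<Sum>w\<in>A. K u w)"
    unfolding K_def by (subst sum.swap, intro sum.cong refl, subst sum.swap) simp
  also have "\<dots> \<le> (\<Sum>u\<in>A. \<Sum>w\<in>A. if w = u then deg else 0)"
    using K_diag K_neg A by (intro sum_mono) (auto simp: B_def)
  also have "\<dots> = deg * card A" using finA by simp
  finally show ?thesis .
qed

text \<open>Cauchy--Schwarz turns the variance bound into a mean absolute deviation of at most
  \<open>sqrt m\<close>. The mean itself is \<open>t \<tau> b * t b e / m\<close>, which
  \<open>t_product\<close> puts within \<open>\<kappa>\<close> of \<open>v\<close>.\<close>

lemma count_deviation:
  assumes x: "x \<in> \<Omega>" and y: "y \<in> nbr x"
  shows "(\<Sum>z\<in>nbr y. \<bar>real (card {u \<in> I. x u = \<tau> \<and> y u = b \<and> z u = e}) - v\<bar>) \<le> deg * (sqrt m + \<kappa>)"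
proof -
  define A where "A = {u \<in> I. x u = \<tau> \<and> y u = b}"
  have yS: "y \<in> \<Omega>" using y nbr_subset by auto
  have cA: "card A = t \<tau> b" using y by (simp add: A_def nbr_def adj_def)
  have tm: "t \<tau> b \<le> m" using t_row[of \<tau>] member_le_sum[of b UNIV "t \<tau>"] by auto
  define s where "s z = real (card {u \<in> A. z u = e}) - real (card A) * real (t b e) / m" for z
  have "(\<Sum>z\<in>nbr y. \<bar>s z\<bar>)\<^sup>2 \<le> real (card (nbr y)) * (\<Sum>z\<in>nbr y. \<bar>s z\<bar>\<^sup>2)"
    using sum_squared_le_sum_of_squares[of "\<lambda>z. \<bar>s z\<bar>" "nbr y"] by (simp add: mult.commute)
  also have "\<dots> = deg * (\<Sum>z\<in>nbr y. (s z)\<^sup>2)" using card_nbr[OF yS] by simp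
  also have "\<dots> \<le> deg * (deg * card A)"
    unfolding s_def by (intro mult_left_mono count_variance[OF yS, of A b e]) (auto simp: A_def deg_def)
  also have "\<dots> \<le> deg * (deg * m)"
    using tm cA by (intro mult_left_mono) (auto simp: deg_def)
  also have "\<dots> = (deg * sqrt m)\<^sup>2" by (simp add: power2_eq_square)
  finally have 1: "(\<Sum>z\<in>nbr y. \<bar>s z\<bar>) \<le> deg * sqrt m"
    by (rule power2_le_imp_le) (auto simp: deg_def)
  have "(\<Sum>z\<in>nbr y. \<bar>real (card {u \<in> I. x u = \<tau> \<and> y u = b \<and> z u = e}) - v\<bar>) \<le> (\<Sum>z\<in>nbr y. \<bar>s z\<bar> + \<kappa>)"
  proof (intro sum_mono)
    fix z
    have "{u \<in> I. x u = \<tau> \<and> y u = b \<and> z u = e} = {u \<in> A. z u = e}" by (auto simp: A_def)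
    then show "\<bar>real (card {u \<in> I. x u = \<tau> \<and> y u = b \<and> z u = e}) - v\<bar> \<le> \<bar>s z\<bar> + \<kappa>"
      using t_product[of \<tau> b e] by (simp add: s_def cA)
  qed
  also have "\<dots> = (\<Sum>z\<in>nbr y. \<bar>s z\<bar>) + deg * \<kappa>"
    using card_nbr[OF yS] by (simp add: sum.distrib)
  finally show ?thesis using 1 by (simp add: algebra_simps)
qed

section \<open>Common neighbours before and after a transposition\<close>

text \<open>
  Let \<open>x'\<close> be \<open>x\<close> with the coordinates \<open>i\<close> and \<open>j\<close> exchanged. A point \<open>y\<close> with \<open>y i = y j\<close> is
  adjacent to \<open>x\<close> iff it is adjacent to \<open>x'\<close>, so \<open>x\<close> and \<open>x'\<close> have the same number of common
  neighbours with \<open>z\<close> of this kind. Hence the total numbers of common neighbours can differ only as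
  far as such \<open>y\<close> fail to make up exactly a fraction \<open>1 / q\<close> of them.
\<close>

definition collision_excess :: "('i \<Rightarrow> 'c) \<Rightarrow> 'i \<Rightarrow> 'i \<Rightarrow> ('i \<Rightarrow> 'c) \<Rightarrow> real" where
  "collision_excess x i j z = (\<Sum>y\<in>nbr x \<inter> nbr z. 1 - q * of_bool (y i = y j))"

text \<open>Relabelling the middle point \<open>y\<close> moves the transposition from
  \<open>x\<close> to \<open>z\<close>.\<close>

lemma sum_nbr_inter_transpose:
  assumes "i \<in> I" "j \<in> I"
  shows "(\<Sum>y\<in>nbr (x \<circ> transpose i j) \<inter> nbr z. f y)
    = (\<Sum>y\<in>nbr x \<inter> nbr (z \<circ> transpose i j). (f (y \<circ> transpose i j) :: real))"
proof (rule sum.reindex_bij_witness[where i = "\<lambda>y. y \<circ> transpose i j" and j = "\<lambda>y. y \<circ> transpose i j"])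
  show "y \<circ> transpose i j \<in> nbr x \<inter> nbr (z \<circ> transpose i j)"
    if "y \<in> nbr (x \<circ> transpose i j) \<inter> nbr z" for y
    using that unfolding Int_iff nbr_transpose_iff[OF assms] comp_transpose_involutory .
  show "y \<circ> transpose i j \<in> nbr (x \<circ> transpose i j) \<inter> nbr z"
    if "y \<in> nbr x \<inter> nbr (z \<circ> transpose i j)" for y
    using that unfolding Int_iff nbr_transpose_iff[OF assms] comp_transpose_involutory .
qed (simp_all only: comp_transpose_involutory)

text \<open>The exchange of \<open>j\<close> and \<open>u\<close> fixes \<open>x\<close>, so
  renaming coordinates lets it act on \<open>z\<close> alone and turns the test
  \<open>y i = y j\<close> into \<open>y i = y u\<close>.\<close>

lemma collision_excess_transpose:
  assumes "j \<in> I" "u \<in> I" "x j = x u" "i \<noteq> j" "i \<noteq> u"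
  shows "collision_excess x i j (z \<circ> transpose j u) = collision_excess x i u z"
proof -
  have x: "x \<circ> transpose j u = x" using assms(3) by (rule comp_transpose_same)
  have "collision_excess x i u z = (\<Sum>y\<in>nbr (x \<circ> transpose j u) \<inter> nbr z. 1 - q * of_bool (y i = y u))"
    unfolding x collision_excess_def ..
  also have "\<dots> = (\<Sum>y\<in>nbr x \<inter> nbr (z \<circ> transpose j u).
      1 - q * of_bool ((y \<circ> transpose j u) i = (y \<circ> transpose j u) u))"
    by (rule sum_nbr_inter_transpose[OF assms(1,2)])
  also have "\<dots> = collision_excess x i j (z \<circ> transpose j u)"
    unfolding collision_excess_def using assms(4,5) by simp
  finally show ?thesis ..
qed

lemma collision_excess_swap:
  assumes "i \<in> I" "j \<in> I"
  shows "collision_excess (x \<circ> transpose i j) i j z = collision_excess x i j (z \<circ> transpose i j)"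
  unfolding collision_excess_def sum_nbr_inter_transpose[OF assms]
  by (intro sum.cong refl) (auto simp: of_bool_def)

lemma sum_\<Omega>_transpose:
  assumes "i \<in> I" "j \<in> I"
  shows "(\<Sum>z\<in>\<Omega>. f (z \<circ> transpose i j)) = (\<Sum>z\<in>\<Omega>. f z)"
  by (rule sum_comp_permutes[OF permutes_swap_id[OF assms] slice_comp_permutes])

text \<open>If all \<open>c b\<close> were equal to \<open>w\<close>, the sum and
  \<open>q * c a\<close> would both be \<open>q * w\<close>; their errors are at most one and
  \<open>q\<close> times the total deviation.\<close>

lemma abs_sum_minus_mult_le:
  fixes c :: "'c \<Rightarrow> real"
  shows "\<bar>(\<Sum>b\<in>UNIV. c b) - q * c a\<bar> \<le> 2 * q * (\<Sum>b\<in>UNIV. \<bar>c b - w\<bar>)"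
proof -
  have "q \<ge> 1" by (simp add: q_eq Suc_leI)
  have "(\<Sum>b\<in>UNIV. c b) - q * c a = (\<Sum>b\<in>UNIV. c b - w) - q * (c a - w)"
    by (simp add: q_eq sum_subtractf algebra_simps)
  also have "\<bar>\<dots>\<bar> \<le> \<bar>\<Sum>b\<in>UNIV. c b - w\<bar> + \<bar>q * (c a - w)\<bar>" by (rule abs_triangle_ineq4)
  also have "\<dots> \<le> (\<Sum>b\<in>UNIV. \<bar>c b - w\<bar>) + q * (\<Sum>b\<in>UNIV. \<bar>c b - w\<bar>)"
  proof (rule add_mono[OF sum_abs])
    have "\<bar>c a - w\<bar> \<le> (\<Sum>b\<in>UNIV. \<bar>c b - w\<bar>)" by (rule member_le_sum) auto
    then show "\<bar>q * (c a - w)\<bar> \<le> q * (\<Sum>b\<in>UNIV. \<bar>c b - w\<bar>)" by (simp add: abs_mult q_eq)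
  qed
  also have "\<dots> \<le> 2 * q * (\<Sum>b\<in>UNIV. \<bar>c b - w\<bar>)"
    using mult_right_mono[OF \<open>q \<ge> 1\<close>, of "\<Sum>b\<in>UNIV. \<bar>c b - w\<bar>"] by (simp add: sum_nonneg)
  finally show ?thesis .
qed

text \<open>The factor by which two applications of \<open>T\<close> shrink Lipschitz constants, of
  order \<open>1 / sqrt m\<close> when \<open>\<kappa>\<close> is at most of order
  \<open>sqrt m\<close>. Of \<open>q ^ 3\<close>, one factor comes from
  \<open>abs_sum_minus_mult_le\<close> and two from the sums over the colours \<open>b\<close> and
  \<open>e\<close>.\<close>

definition \<rho> :: real where "\<rho> = 2 * q ^ 3 * (sqrt m + \<kappa>) / m"

lemma \<kappa>_nonneg: "\<kappa> \<ge> 0"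
  using t_product order_trans[OF abs_ge_zero] by blast

lemma \<rho>_nonneg: "\<rho> \<ge> 0"
  unfolding \<rho>_def using \<kappa>_nonneg by (simp add: q_eq)

text \<open>
  The excess does not change when \<open>j\<close> moves inside its \<open>(x, z)\<close>-cell, and its sum over \<open>z\<close> does
  not change when \<open>j\<close> moves inside its \<open>x\<close>-class. After averaging over \<open>j\<close>, the excess measures
  how unevenly the colours of \<open>y\<close> are spread over the \<open>(x, z)\<close>-cells.
\<close>

lemma sum_abs_collision_excess_le:
  assumes x: "x \<in> \<Omega>" and i: "i \<in> I" and j: "j \<in> I" and xij: "x i \<noteq> x j"
  shows "(\<Sum>z\<in>\<Omega>. \<bar>collision_excess x i j z\<bar>) \<le> \<rho> * deg\<^sup>2"
proof -
  define \<tau> where "\<tau> = x j"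
  define B where "B = {u \<in> I. x u = \<tau>}"
  have finB: "finite B" and cardB: "card B = m"
    using x finite_I by (simp_all add: B_def slice_def)
  define C where "C z e = {u \<in> I. x u = \<tau> \<and> z u = e}" for z :: "'i \<Rightarrow> 'c" and e
  define c where "c y z b e = real (card {u \<in> I. x u = \<tau> \<and> y u = b \<and> z u = e})" for y z :: "'i \<Rightarrow> 'c" and b e
  have finC: "finite (C z e)" for z e using finite_I by (simp add: C_def)
  have move: "collision_excess x i u (z \<circ> transpose u w) = collision_excess x i w z"
    if "u \<in> B" "w \<in> B" for u w z
    using that xij by (intro collision_excess_transpose) (auto simp: B_def \<tau>_def)
  \<comment> \<open>The total over \<open>z\<close> is the same for every \<open>u\<close> in the
    class of \<open>j\<close>, so it may be averaged over the \<open>m\<close> elements of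
    \<open>B\<close>; this produces the division by \<open>m\<close> in
    \<open>\<rho>\<close>.\<close>
  have same: "(\<Sum>z\<in>\<Omega>. \<bar>collision_excess x i u z\<bar>) = (\<Sum>z\<in>\<Omega>. \<bar>collision_excess x i j z\<bar>)" if "u \<in> B" for u
  proof -
    have jB: "j \<in> B" using j by (simp add: B_def \<tau>_def)
    have "(\<Sum>z\<in>\<Omega>. \<bar>collision_excess x i u z\<bar>) = (\<Sum>z\<in>\<Omega>. \<bar>collision_excess x i j (z \<circ> transpose j u)\<bar>)"
      unfolding move[OF jB that] ..
    also have "\<dots> = (\<Sum>z\<in>\<Omega>. \<bar>collision_excess x i j z\<bar>)"
      by (rule sum_\<Omega>_transpose) (use j that in \<open>auto simp: B_def\<close>)
    finally show ?thesis .
  qed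
  have cell: "(\<Sum>u\<in>C z e. \<bar>collision_excess x i u z\<bar>) \<le> (\<Sum>y\<in>nbr x \<inter> nbr z. 2 * q * (\<Sum>b\<in>UNIV. \<bar>c y z b e - v\<bar>))"
    for z e
  proof (cases "C z e = {}")
    case True
    then show ?thesis by (simp add: sum_nonneg q_eq)
  next
    case False
    then obtain w where w: "w \<in> C z e" by auto
    have const: "collision_excess x i u z = collision_excess x i w z" if "u \<in> C z e" for u
    proof -
      have "z \<circ> transpose u w = z" using that w by (intro comp_transpose_same) (auto simp: C_def)
      then show ?thesis using move[of u w z] that w by (simp add: C_def B_def)
    qed
    \<comment> \<open>The excess is constant on a cell, so the absolute value can be pulled outside
      the sum over the cell without loss. Only then is that sum taken inside, where the colours of
      \<open>y\<close> cancel.\<close>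
    have "(\<Sum>u\<in>C z e. \<bar>collision_excess x i u z\<bar>) = (\<Sum>u\<in>C z e. \<bar>collision_excess x i w z\<bar>)"
      by (intro sum.cong refl) (simp add: const)
    also have "\<dots> = \<bar>\<Sum>u\<in>C z e. collision_excess x i w z\<bar>" by (simp add: abs_mult)
    also have "(\<Sum>u\<in>C z e. collision_excess x i w z) = (\<Sum>u\<in>C z e. collision_excess x i u z)"
      by (intro sum.cong refl) (simp add: const)
    also have "\<dots> = (\<Sum>y\<in>nbr x \<inter> nbr z. \<Sum>u\<in>C z e. 1 - q * of_bool (y i = y u))"
      unfolding collision_excess_def by (rule sum.swap)
    also have "\<bar>\<dots>\<bar> \<le> (\<Sum>y\<in>nbr x \<inter> nbr z. \<bar>\<Sum>u\<in>C z e. 1 - q * of_bool (y i = y u)\<bar>)"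
      by (rule sum_abs)
    also have "\<dots> \<le> (\<Sum>y\<in>nbr x \<inter> nbr z. 2 * q * (\<Sum>b\<in>UNIV. \<bar>c y z b e - v\<bar>))"
    proof (rule sum_mono)
      fix y
      have cb: "c y z b e = (\<Sum>u\<in>C z e. of_bool (b = y u))" for b
      proof -
        have "{u \<in> I. x u = \<tau> \<and> y u = b \<and> z u = e} = C z e \<inter> {u. b = y u}" by (auto simp: C_def)
        then show ?thesis using finC by (simp add: c_def of_bool_def sum.If_cases)
      qed
      have "(\<Sum>b\<in>UNIV. c y z b e) = (\<Sum>u\<in>C z e. \<Sum>b\<in>UNIV. of_bool (b = y u))"
        unfolding cb by (rule sum.swap)
      also have "\<dots> = real (card (C z e))" by (simp add: of_bool_def)
      finally have "(\<Sum>u\<in>C z e. 1 - q * of_bool (y i = y u)) = (\<Sum>b\<in>UNIV. c y z b e) - q * c y z (y i) e"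
        by (simp add: sum_subtractf cb sum_distrib_left)
      then show "\<bar>\<Sum>u\<in>C z e. 1 - q * of_bool (y i = y u)\<bar> \<le> 2 * q * (\<Sum>b\<in>UNIV. \<bar>c y z b e - v\<bar>)"
        using abs_sum_minus_mult_le[of "\<lambda>b. c y z b e" "y i" v] by simp
    qed
    finally show ?thesis .
  qed
  have "m * (\<Sum>z\<in>\<Omega>. \<bar>collision_excess x i j z\<bar>) = (\<Sum>u\<in>B. \<Sum>z\<in>\<Omega>. \<bar>collision_excess x i u z\<bar>)"
    using same cardB by simp
  also have "\<dots> = (\<Sum>z\<in>\<Omega>. \<Sum>u\<in>B. \<bar>collision_excess x i u z\<bar>)" by (rule sum.swap)
  also have "\<dots> = (\<Sum>z\<in>\<Omega>. \<Sum>e\<in>UNIV. \<Sum>u\<in>C z e. \<bar>collision_excess x i u z\<bar>)"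
  proof (intro sum.cong refl)
    fix z
    have "(\<Sum>u\<in>B. \<bar>collision_excess x i u z\<bar>) = (\<Sum>e\<in>UNIV. \<Sum>u | u \<in> B \<and> z u = e. \<bar>collision_excess x i u z\<bar>)"
      by (rule sum.group[symmetric]) (use finB in auto)
    moreover have "{u. u \<in> B \<and> z u = e} = C z e" for e by (auto simp: B_def C_def)
    ultimately show "(\<Sum>u\<in>B. \<bar>collision_excess x i u z\<bar>) = (\<Sum>e\<in>UNIV. \<Sum>u\<in>C z e. \<bar>collision_excess x i u z\<bar>)"
      by simp
  qed
  also have "\<dots> \<le> (\<Sum>z\<in>\<Omega>. \<Sum>e\<in>UNIV. \<Sum>y\<in>nbr x \<inter> nbr z. 2 * q * (\<Sum>b\<in>UNIV. \<bar>c y z b e - v\<bar>))"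
    by (intro sum_mono cell)
  also have "\<dots> = (\<Sum>z\<in>\<Omega>. \<Sum>y\<in>nbr x \<inter> nbr z. \<Sum>e\<in>UNIV. 2 * q * (\<Sum>b\<in>UNIV. \<bar>c y z b e - v\<bar>))"
    by (intro sum.cong refl sum.swap)
  \<comment> \<open>The pairs \<open>z\<close>, \<open>y\<close> are read as walks of two steps with
    \<open>y\<close> chosen first, the order in which \<open>count_deviation\<close> bounds the
    deviation.\<close>
  also have "\<dots> = (\<Sum>y\<in>nbr x. \<Sum>z\<in>nbr y. \<Sum>e\<in>UNIV. 2 * q * (\<Sum>b\<in>UNIV. \<bar>c y z b e - v\<bar>))"
    by (rule sum_nbr_common[OF x])
  also have "\<dots> = (\<Sum>y\<in>nbr x. \<Sum>e\<in>UNIV. \<Sum>b\<in>UNIV. 2 * q * (\<Sum>z\<in>nbr y. \<bar>c y z b e - v\<bar>))"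
  proof (intro sum.cong refl)
    fix y
    have "(\<Sum>z\<in>nbr y. \<Sum>e\<in>UNIV. 2 * q * (\<Sum>b\<in>UNIV. \<bar>c y z b e - v\<bar>))
        = (\<Sum>e\<in>UNIV. \<Sum>z\<in>nbr y. \<Sum>b\<in>UNIV. 2 * q * \<bar>c y z b e - v\<bar>)"
      by (subst sum.swap) (simp only: sum_distrib_left)
    also have "\<dots> = (\<Sum>e\<in>UNIV. \<Sum>b\<in>UNIV. \<Sum>z\<in>nbr y. 2 * q * \<bar>c y z b e - v\<bar>)"
      by (intro sum.cong refl sum.swap)
    finally show "(\<Sum>z\<in>nbr y. \<Sum>e\<in>UNIV. 2 * q * (\<Sum>b\<in>UNIV. \<bar>c y z b e - v\<bar>))
        = (\<Sum>e\<in>UNIV. \<Sum>b\<in>UNIV. 2 * q * (\<Sum>z\<in>nbr y. \<bar>c y z b e - v\<bar>))"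
      by (simp only: sum_distrib_left)
  qed
  also have "\<dots> \<le> (\<Sum>y\<in>nbr x. \<Sum>e\<in>(UNIV :: 'c set). \<Sum>b\<in>(UNIV :: 'c set). 2 * q * (deg * (sqrt m + \<kappa>)))"
    unfolding c_def using count_deviation[OF x] by (intro sum_mono mult_left_mono) (auto simp: q_eq)
  also have "\<dots> = 2 * q ^ 3 * (sqrt m + \<kappa>) * deg\<^sup>2"
    using card_nbr[OF x] by (simp add: q_eq power2_eq_square power3_eq_cube)
  finally show ?thesis using m_pos by (simp add: \<rho>_def field_simps)
qed

section \<open>The averaging operator: contraction and correlation\<close>

text \<open>The Markov operator of the random walk on the graph; symmetry of \<open>adj\<close>
  makes it self-adjoint for the uniform measure on \<open>\<Omega>\<close>.\<close>

definition T :: "(('i \<Rightarrow> 'c) \<Rightarrow> real) \<Rightarrow> ('i \<Rightarrow> 'c) \<Rightarrow> real" where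
  "T f x = (\<Sum>y\<in>nbr x. f y) / deg"

lemma T_self_adjoint: "(\<Sum>x\<in>\<Omega>. f x * T g x) = (\<Sum>x\<in>\<Omega>. T f x * g x)"
proof -
  have "(\<Sum>x\<in>\<Omega>. f x * T g x) = (\<Sum>x\<in>\<Omega>. \<Sum>y\<in>nbr x. f x * g y) / deg"
    by (simp add: T_def sum_distrib_left sum_divide_distrib)
  also have "\<dots> = (\<Sum>y\<in>\<Omega>. \<Sum>x\<in>nbr y. f x * g y) / deg" by (subst sum_nbr_swap) (rule refl)
  also have "\<dots> = (\<Sum>x\<in>\<Omega>. T f x * g x)"
    by (simp add: T_def sum_distrib_right sum_divide_distrib)
  finally show ?thesis .
qed

lemma T_T:
  assumes "x \<in> \<Omega>"
  shows "T (T f) x = (\<Sum>z\<in>\<Omega>. f z * card (nbr x \<inter> nbr z)) / deg\<^sup>2"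
proof -
  have "T (T f) x = (\<Sum>y\<in>nbr x. \<Sum>z\<in>nbr y. f z) / deg\<^sup>2"
    by (simp add: T_def power2_eq_square sum_divide_distrib[symmetric])
  also have "(\<Sum>y\<in>nbr x. \<Sum>z\<in>nbr y. f z) = (\<Sum>z\<in>\<Omega>. \<Sum>y\<in>nbr x \<inter> nbr z. f z)"
    by (rule sum_nbr_common[OF assms, symmetric])
  finally show ?thesis by (simp add: mult.commute)
qed

text \<open>\<open>T (T f) x\<close> weights \<open>f z\<close> by the number of common neighbours
  of \<open>x\<close> and \<open>z\<close>. The middle points with equal colours at \<open>i\<close>
  and \<open>j\<close> are shared by \<open>x\<close> and its transposed copy, so only a difference
  of collision excesses remains; reindexing \<open>z\<close> moves that difference onto
  \<open>f\<close>, where the Lipschitz bound applies.\<close>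

lemma T_T_Lipschitz:
  assumes lip: "\<And>x i j. x \<in> \<Omega> \<Longrightarrow> i \<in> I \<Longrightarrow> j \<in> I \<Longrightarrow> \<bar>f x - f (x \<circ> transpose i j)\<bar> \<le> L"
    and deg: "deg > 0" and "L \<ge> 0" and x: "x \<in> \<Omega>" and i: "i \<in> I" and j: "j \<in> I"
  shows "\<bar>T (T f) x - T (T f) (x \<circ> transpose i j)\<bar> \<le> \<rho> * L"
proof (cases "x i = x j")
  case True
  show ?thesis unfolding comp_transpose_same[of x i j, OF True] using \<rho>_nonneg \<open>L \<ge> 0\<close> by simp
next
  case False
  define x' where "x' = x \<circ> transpose i j"
  have x': "x' \<in> \<Omega>" unfolding x'_def by (rule slice_transpose[OF i j x])
  have agree: "y \<in> nbr x \<longleftrightarrow> y \<in> nbr x'" if "y i = y j" for y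
    unfolding x'_def nbr_transpose_iff[OF i j] comp_transpose_same[of y i j, OF that] ..
  have excess: "real (card (nbr w \<inter> nbr z)) - q * card {y \<in> nbr w \<inter> nbr z. y i = y j} = collision_excess w i j z" for w z
    unfolding collision_excess_def using finite_nbr[of w]
    by (simp add: sum_subtractf sum_distrib_left[symmetric] of_bool_def sum.If_cases Int_def conj_assoc)
  have "{y \<in> nbr x \<inter> nbr z. y i = y j} = {y \<in> nbr x' \<inter> nbr z. y i = y j}" for z
    using agree by auto
  then have diff: "real (card (nbr x \<inter> nbr z)) - card (nbr x' \<inter> nbr z)
      = collision_excess x i j z - collision_excess x i j (z \<circ> transpose i j)" for z
    using excess[of x z] excess[of x' z] collision_excess_swap[OF i j, of x z] by (simp add: x'_def)
  have "deg\<^sup>2 * (T (T f) x - T (T f) x')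
      = (\<Sum>z\<in>\<Omega>. f z * (real (card (nbr x \<inter> nbr z)) - card (nbr x' \<inter> nbr z)))"
    using deg by (simp add: T_T[OF x] T_T[OF x'] field_simps sum_subtractf)
  also have "\<dots> = (\<Sum>z\<in>\<Omega>. f z * collision_excess x i j z) - (\<Sum>z\<in>\<Omega>. f z * collision_excess x i j (z \<circ> transpose i j))"
    unfolding diff by (simp add: algebra_simps sum_subtractf)
  also have "(\<Sum>z\<in>\<Omega>. f z * collision_excess x i j (z \<circ> transpose i j))
      = (\<Sum>z\<in>\<Omega>. f (z \<circ> transpose i j) * collision_excess x i j z)"
    using sum_\<Omega>_transpose[OF i j, of "\<lambda>z. f (z \<circ> transpose i j) * collision_excess x i j z"]
    unfolding comp_transpose_involutory .
  also have "(\<Sum>z\<in>\<Omega>. f z * collision_excess x i j z) - \<dots>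
      = (\<Sum>z\<in>\<Omega>. (f z - f (z \<circ> transpose i j)) * collision_excess x i j z)"
    unfolding sum_subtractf[symmetric] left_diff_distrib ..
  finally have "deg\<^sup>2 * (T (T f) x - T (T f) x')
      = (\<Sum>z\<in>\<Omega>. (f z - f (z \<circ> transpose i j)) * collision_excess x i j z)" .
  from arg_cong[OF this, of abs] have "deg\<^sup>2 * \<bar>T (T f) x - T (T f) x'\<bar>
      = \<bar>\<Sum>z\<in>\<Omega>. (f z - f (z \<circ> transpose i j)) * collision_excess x i j z\<bar>"
    unfolding abs_mult abs_power2 .
  also have "\<dots> \<le> (\<Sum>z\<in>\<Omega>. \<bar>(f z - f (z \<circ> transpose i j)) * collision_excess x i j z\<bar>)" by (rule sum_abs)
  also have "\<dots> \<le> (\<Sum>z\<in>\<Omega>. L * \<bar>collision_excess x i j z\<bar>)"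
    unfolding abs_mult by (intro sum_mono mult_right_mono lip i j) auto
  also have "\<dots> = L * (\<Sum>z\<in>\<Omega>. \<bar>collision_excess x i j z\<bar>)" by (rule sum_distrib_left[symmetric])
  also have "\<dots> \<le> L * (\<rho> * deg\<^sup>2)"
    by (intro mult_left_mono sum_abs_collision_excess_le x i j False \<open>L \<ge> 0\<close>)
  also have "\<dots> = deg\<^sup>2 * (\<rho> * L)" by simp
  finally show ?thesis using deg unfolding x'_def[symmetric] by (simp only: mult_le_cancel_left_pos zero_less_power)
qed

lemma sum_T:
  assumes "deg > 0"
  shows "(\<Sum>x\<in>\<Omega>. T f x) = (\<Sum>x\<in>\<Omega>. f x)"
proof -
  have "T (\<lambda>_. 1) x = 1" if "x \<in> \<Omega>" for x
    using assms card_nbr[OF that] by (simp add: T_def)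
  then show ?thesis using T_self_adjoint[of "\<lambda>_. 1" f] by simp
qed

lemma T_pow_self_adjoint:
  "(\<Sum>x\<in>\<Omega>. f x * (T ^^ k) g x) = (\<Sum>x\<in>\<Omega>. (T ^^ k) f x * g x)"
proof (induction k arbitrary: g)
  case (Suc k)
  have "(\<Sum>x\<in>\<Omega>. f x * (T ^^ Suc k) g x) = (\<Sum>x\<in>\<Omega>. f x * (T ^^ k) (T g) x)"
    by (simp only: funpow_Suc_right o_apply)
  also have "\<dots> = (\<Sum>x\<in>\<Omega>. (T ^^ k) f x * T g x)" by (rule Suc)
  also have "\<dots> = (\<Sum>x\<in>\<Omega>. (T ^^ Suc k) f x * g x)" by (subst T_self_adjoint) simp
  finally show ?case .
qed simp

text \<open>Self-adjointness identifies the last inner product with the squared norm of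
  \<open>(T ^^ k) g\<close>.\<close>

lemma T_pow_Cauchy_Schwarz:
  "(\<Sum>x\<in>\<Omega>. g x * (T ^^ k) g x)\<^sup>2 \<le> (\<Sum>x\<in>\<Omega>. (g x)\<^sup>2) * (\<Sum>x\<in>\<Omega>. g x * (T ^^ (k + k)) g x)"
proof -
  have "(\<Sum>x\<in>\<Omega>. g x * (T ^^ (k + k)) g x) = (\<Sum>x\<in>\<Omega>. ((T ^^ k) g x)\<^sup>2)"
    unfolding funpow_add o_apply by (subst T_pow_self_adjoint) (simp add: power2_eq_square)
  then show ?thesis using Cauchy_Schwarz_ineq_sum[of g "(T ^^ k) g" \<Omega>] by simp
qed

lemma T_pow_Lipschitz:
  assumes deg: "deg > 0"
    and lip: "\<And>x i j. x \<in> \<Omega> \<Longrightarrow> i \<in> I \<Longrightarrow> j \<in> I \<Longrightarrow> \<bar>g x - g (x \<circ> transpose i j)\<bar> \<le> 1"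
    and "x \<in> \<Omega>" "i \<in> I" "j \<in> I"
  shows "\<bar>(T ^^ (2 * k)) g x - (T ^^ (2 * k)) g (x \<circ> transpose i j)\<bar> \<le> \<rho> ^ k"
  using assms(3-5)
proof (induction k arbitrary: x i j)
  case (Suc k)
  have "(T ^^ (2 * Suc k)) g = T (T ((T ^^ (2 * k)) g))" by simp
  moreover have "\<bar>T (T ((T ^^ (2 * k)) g)) x - T (T ((T ^^ (2 * k)) g)) (x \<circ> transpose i j)\<bar> \<le> \<rho> * \<rho> ^ k"
    by (rule T_T_Lipschitz[of "(T ^^ (2 * k)) g" "\<rho> ^ k", OF Suc.IH deg zero_le_power[OF \<rho>_nonneg] Suc.prems])
  ultimately show ?case unfolding power_Suc by (simp only:)
qed (use lip in \<open>simp only: mult_0_right funpow_0 power_0\<close>)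

text \<open>\<open>T\<close> preserves the mean, so the iterate has mean zero and deviates from it
  by at most the diameter times its Lipschitz constant.\<close>

lemma T_pow_bounded:
  assumes deg: "deg > 0"
    and lip: "\<And>x i j. x \<in> \<Omega> \<Longrightarrow> i \<in> I \<Longrightarrow> j \<in> I \<Longrightarrow> \<bar>g x - g (x \<circ> transpose i j)\<bar> \<le> 1"
    and mean: "(\<Sum>x\<in>\<Omega>. g x) = 0"
    and x: "x \<in> \<Omega>"
  shows "\<bar>(T ^^ (2 * k)) g x\<bar> \<le> card I * \<rho> ^ k"
proof -
  define h where "h = (T ^^ (2 * k)) g"
  have "(\<Sum>x\<in>\<Omega>. (T ^^ k) g x) = 0" for k
    by (induction k) (simp_all add: mean sum_T[OF deg])
  then have "(\<Sum>y\<in>\<Omega>. h y) = 0" by (simp add: h_def)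
  then have "real (card \<Omega>) * h x = (\<Sum>y\<in>\<Omega>. h x - h y)" by (simp add: sum_subtractf)
  then have "real (card \<Omega>) * \<bar>h x\<bar> = \<bar>\<Sum>y\<in>\<Omega>. h x - h y\<bar>"
    by (metis abs_mult abs_of_nat)
  also have "\<dots> \<le> (\<Sum>y\<in>\<Omega>. \<bar>h x - h y\<bar>)" by (rule sum_abs)
  also have "\<dots> \<le> (\<Sum>y\<in>\<Omega>. card I * \<rho> ^ k)"
  proof (rule sum_mono)
    fix y assume y: "y \<in> \<Omega>"
    show "\<bar>h x - h y\<bar> \<le> card I * \<rho> ^ k"
    proof (rule slice_Lipschitz[of I "\<lambda>_. m" h "\<rho> ^ k", OF finite_I _ _ x y])
      show "\<bar>h z - h (z \<circ> transpose i j)\<bar> \<le> \<rho> ^ k" if "z \<in> \<Omega>" "i \<in> I" "j \<in> I" for z i j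
        unfolding h_def by (rule T_pow_Lipschitz[of g, OF deg lip that])
    qed (simp add: \<rho>_nonneg)
  qed
  also have "\<dots> = real (card \<Omega>) * (card I * \<rho> ^ k)" by simp
  finally show ?thesis
    using x finite_\<Omega> card_gt_0_iff[of \<Omega>] unfolding h_def[symmetric] by (subst (asm) mult_le_cancel_left_pos) auto
qed

text \<open>
  The contraction estimate only becomes useful for a high power of \<open>T\<close>; Cauchy--Schwarz brings it
  back to \<open>T\<close> itself.
\<close>

lemma correlation_le:
  fixes S :: "('i \<Rightarrow> 'c) set" and \<mu> l :: real and g :: "('i \<Rightarrow> 'c) \<Rightarrow> real"
  defines "\<mu> \<equiv> real (card S) / card \<Omega>"
  defines "g \<equiv> \<lambda>x. of_bool (x \<in> S) - \<mu>"
  assumes deg: "deg > 0" and S: "S \<subseteq> \<Omega>" "S \<noteq> {}" and l: "l \<ge> 0" "l ^ 8 = 2 * card I * \<rho> ^ 4"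
  shows "(\<Sum>x\<in>\<Omega>. (g x)\<^sup>2) \<le> card S" "(\<Sum>x\<in>\<Omega>. g x * T g x) \<le> card S * l"
proof -
  have cS: "real (card S) > 0" and fS: "finite S" using S finite_\<Omega> finite_subset by (auto simp: card_gt_0_iff)
  have c\<Omega>: "real (card \<Omega>) > 0" using S finite_\<Omega> by (auto simp: card_gt_0_iff)
  have \<mu>: "0 \<le> \<mu>" "\<mu> \<le> 1" "card \<Omega> * \<mu> = card S"
    using c\<Omega> card_mono[OF finite_\<Omega> S(1)] by (auto simp: \<mu>_def)
  have sumS: "(\<Sum>x\<in>\<Omega>. of_bool (x \<in> S)) = real (card S)"
    using S(1) finite_\<Omega> by (simp add: of_bool_def sum.If_cases Int_absorb1)
  have mean: "(\<Sum>x\<in>\<Omega>. g x) = 0" using sumS \<mu> by (simp add: g_def sum_subtractf)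
  have lip: "\<bar>g x - g y\<bar> \<le> 1" for x y by (simp add: g_def of_bool_def)
  have "(\<Sum>x\<in>\<Omega>. (g x)\<^sup>2) = (\<Sum>x\<in>\<Omega>. of_bool (x \<in> S) * (1 - \<mu>) - \<mu> * g x)"
    by (intro sum.cong refl) (auto simp: g_def of_bool_def power2_eq_square algebra_simps)
  also have "\<dots> = card S * (1 - \<mu>)"
    by (simp only: sum_subtractf sum_distrib_right[symmetric] sum_distrib_left[symmetric] sumS mean)
  also have "\<dots> \<le> real (card S) * 1" using \<mu> by (intro mult_left_mono) auto
  finally show a0: "(\<Sum>x\<in>\<Omega>. (g x)\<^sup>2) \<le> card S" by simp
  define a where "a k = (\<Sum>x\<in>\<Omega>. g x * (T ^^ k) g x)" for k
  define b where "b = (\<Sum>x\<in>\<Omega>. (g x)\<^sup>2)"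
  have b: "0 \<le> b" "b \<le> card S" using a0 by (auto simp: b_def sum_nonneg)
  have cs: "(a k)\<^sup>2 \<le> b * a (k + k)" for k
    unfolding a_def b_def by (rule T_pow_Cauchy_Schwarz)
  \<comment> \<open>With \<open>\<rho>\<close> of order \<open>1 / sqrt (card I)\<close>, 8 is the
    first power of two among the exponents of \<open>T\<close> for which the resulting bound, here
    \<open>card I * \<rho> ^ 4\<close>, tends to 0.\<close>
  have "a 8 \<le> (\<Sum>x\<in>\<Omega>. \<bar>g x\<bar> * (card I * \<rho> ^ 4))"
    unfolding a_def
  proof (rule sum_mono)
    fix x assume x: "x \<in> \<Omega>"
    have "g x * (T ^^ 8) g x \<le> \<bar>g x\<bar> * \<bar>(T ^^ 8) g x\<bar>" by (metis abs_ge_self abs_mult)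
    also have "\<dots> \<le> \<bar>g x\<bar> * (card I * \<rho> ^ 4)"
      using T_pow_bounded[OF deg lip mean x, of 4] by (intro mult_left_mono) auto
    finally show "g x * (T ^^ 8) g x \<le> \<bar>g x\<bar> * (card I * \<rho> ^ 4)" .
  qed
  also have "\<dots> = (\<Sum>x\<in>\<Omega>. \<bar>g x\<bar>) * (card I * \<rho> ^ 4)" by (rule sum_distrib_right[symmetric])
  also have "\<dots> \<le> (2 * card S) * (card I * \<rho> ^ 4)"
  proof (rule mult_right_mono)
    have "(\<Sum>x\<in>\<Omega>. \<bar>g x\<bar>) \<le> (\<Sum>x\<in>\<Omega>. of_bool (x \<in> S) + \<mu>)"
      using \<mu> by (intro sum_mono) (auto simp: g_def of_bool_def)
    also have "\<dots> = 2 * card S" using sumS \<mu> by (simp add: sum.distrib)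
    finally show "(\<Sum>x\<in>\<Omega>. \<bar>g x\<bar>) \<le> real (2 * card S)" by simp
  qed (simp add: \<rho>_nonneg)
  finally have a8: "a 8 \<le> card S * l ^ 8" using l by (simp add: algebra_simps)
  \<comment> \<open>Three uses of Cauchy--Schwarz, for the exponents 1, 2 and 4, lead from
    \<open>a 1\<close> to \<open>a 8\<close> and give
    \<open>a 1 ^ 8 \<le> b ^ 7 * a 8\<close>.\<close>
  have "(a 1) ^ 8 = ((a 1)\<^sup>2) ^ 4" by simp
  also have "\<dots> \<le> (b * a 2) ^ 4" using cs[of 1] by (intro power_mono) (auto simp: numeral_2_eq_2)
  also have "\<dots> = b ^ 4 * ((a 2)\<^sup>2)\<^sup>2" by (simp add: power_mult_distrib)
  also have "\<dots> \<le> b ^ 4 * (b * a 4)\<^sup>2"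
    using cs[of 2] b by (intro mult_left_mono power_mono) auto
  also have "\<dots> = b ^ 6 * (a 4)\<^sup>2" by (simp add: power_mult_distrib flip: power_add)
  also have "\<dots> \<le> b ^ 6 * (b * a 8)" using cs[of 4] b by (intro mult_left_mono) auto
  also have "\<dots> = b ^ 7 * a 8" by (simp add: eval_nat_numeral)
  also have "\<dots> \<le> b ^ 7 * (card S * l ^ 8)" using a8 b by (intro mult_left_mono) auto
  also have "\<dots> \<le> real (card S) ^ 7 * (card S * l ^ 8)"
    using b l by (intro mult_right_mono power_mono) auto
  also have "\<dots> = (card S * l) ^ 8" by (simp add: power_mult_distrib eval_nat_numeral)
  finally have p: "a 1 ^ 8 \<le> (card S * l) ^ 8" .
  have "a 1 \<le> card S * l"
  proof (rule ccontr)
    assume "\<not> a 1 \<le> card S * l"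
    then have "(card S * l) ^ 8 < a 1 ^ 8" using l by (intro power_strict_mono) auto
    then show False using p by simp
  qed
  then show "(\<Sum>x\<in>\<Omega>. g x * T g x) \<le> card S * l" by (simp add: a_def)
qed

section \<open>The second moment bound\<close>

text \<open>Chebyshev's inequality: if no point lands in \<open>S\<close>, the sum of the centred
  indicators is \<open>- card W * \<mu>\<close>. On average over the permutations, each diagonal
  term of its square is at most \<open>\<mu>\<close> and, distinct points being adjacent, each other
  term at most \<open>\<mu> * l\<close>.\<close>

lemma few_permutations_miss:
  fixes S :: "('i \<Rightarrow> 'c) set" and \<mu> l :: real and \<Phi> :: "'w \<Rightarrow> 'i \<Rightarrow> 'c"
  defines "\<mu> \<equiv> real (card S) / card \<Omega>"
  assumes deg: "deg > 0" and S: "S \<subseteq> \<Omega>" "S \<noteq> {}" and l: "l \<ge> 0" "l ^ 8 = 2 * card I * \<rho> ^ 4"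
    and W: "finite W" "W \<noteq> {}" and \<Phi>: "\<And>w. w \<in> W \<Longrightarrow> \<Phi> w \<in> \<Omega>"
    and \<Phi>2: "\<And>w w'. w \<in> W \<Longrightarrow> w' \<in> W \<Longrightarrow> w \<noteq> w' \<Longrightarrow> adj (\<Phi> w) (\<Phi> w')"
  shows "card {p. p permutes I \<and> (\<forall>w\<in>W. \<Phi> w \<circ> p \<notin> S)} \<le> fact (card I) * (1 / (card W * \<mu>) + l / \<mu>)"
proof -
  define g where "g = (\<lambda>x. of_bool (x \<in> S) - \<mu>)"
  have c\<Omega>: "real (card \<Omega>) > 0" using S finite_\<Omega> by (auto simp: card_gt_0_iff)
  have "real (card S) > 0" using S finite_subset[OF S(1) finite_\<Omega>] by (simp add: card_gt_0_iff)
  then have \<mu>: "\<mu> > 0" using c\<Omega> by (simp add: \<mu>_def)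
  have cW: "real (card W) > 0" using W by (simp add: card_gt_0_iff)
  define F where "F = {p. p permutes I \<and> (\<forall>w\<in>W. \<Phi> w \<circ> p \<notin> S)}"
  have finp: "finite {p. p permutes I}" using finite_I by (rule finite_permutations)
  define Y where "Y p = (\<Sum>w\<in>W. g (\<Phi> w \<circ> p))" for p
  have pair: "(\<Sum>p | p permutes I. g (\<Phi> w \<circ> p) * g (\<Phi> w' \<circ> p)) \<le> fact (card I) * \<mu> * ((if w' = w then 1 else 0) + l)"
    if w: "w \<in> W" "w' \<in> W" for w w'
  proof (cases "w' = w")
    case True
    have "(\<Sum>p | p permutes I. g (\<Phi> w \<circ> p) * g (\<Phi> w' \<circ> p)) = (\<Sum>p | p permutes I. (g (\<Phi> w \<circ> p))\<^sup>2)"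
      using True by (simp add: power2_eq_square)
    also have "\<dots> = fact (card I) * (\<Sum>y\<in>\<Omega>. (g y)\<^sup>2) / card \<Omega>"
      by (rule sum_permutes_slice[OF finite_I \<Phi>[OF w(1)]])
    also have "\<dots> \<le> fact (card I) * card S / card \<Omega>"
      using correlation_le(1)[OF deg S l] by (intro divide_right_mono mult_left_mono) (auto simp: g_def \<mu>_def)
    also have "\<dots> = fact (card I) * \<mu> * 1" by (simp add: \<mu>_def)
    also have "\<dots> \<le> fact (card I) * \<mu> * (1 + l)" using \<mu> l by (intro mult_left_mono) auto
    finally show ?thesis using True by simp
  next
    case False
    have "(\<Sum>p | p permutes I. g (\<Phi> w \<circ> p) * g (\<Phi> w' \<circ> p))
        = fact (card I) * (\<Sum>x\<in>\<Omega>. \<Sum>y\<in>nbr x. g x * g y) / (card \<Omega> * deg)"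
      using False w by (intro sum_permutes_adj \<Phi>2) auto
    also have "\<dots> = fact (card I) * (\<Sum>x\<in>\<Omega>. g x * T g x) / card \<Omega>"
      by (simp add: T_def sum_distrib_left[symmetric] sum_divide_distrib[symmetric])
    also have "\<dots> \<le> fact (card I) * (card S * l) / card \<Omega>"
      using correlation_le(2)[OF deg S l] by (intro divide_right_mono mult_left_mono) (auto simp: g_def \<mu>_def)
    also have "\<dots> = fact (card I) * \<mu> * l" by (simp add: \<mu>_def)
    finally show ?thesis using False by simp
  qed
  have "card F * (card W * \<mu>)\<^sup>2 = (\<Sum>p\<in>F. (Y p)\<^sup>2)"
  proof -
    have "(Y p)\<^sup>2 = (card W * \<mu>)\<^sup>2" if "p \<in> F" for p
      using that by (simp add: Y_def g_def F_def)
    then show ?thesis by simp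
  qed
  also have "\<dots> \<le> (\<Sum>p | p permutes I. (Y p)\<^sup>2)"
    using finp by (intro sum_mono2) (auto simp: F_def)
  also have "\<dots> = (\<Sum>p | p permutes I. \<Sum>w\<in>W. \<Sum>w'\<in>W. g (\<Phi> w \<circ> p) * g (\<Phi> w' \<circ> p))"
    by (simp add: Y_def power2_eq_square sum_product)
  also have "\<dots> = (\<Sum>w\<in>W. \<Sum>p | p permutes I. \<Sum>w'\<in>W. g (\<Phi> w \<circ> p) * g (\<Phi> w' \<circ> p))"
    by (rule sum.swap)
  also have "\<dots> = (\<Sum>w\<in>W. \<Sum>w'\<in>W. \<Sum>p | p permutes I. g (\<Phi> w \<circ> p) * g (\<Phi> w' \<circ> p))"
    by (intro sum.cong refl sum.swap)
  also have "\<dots> \<le> (\<Sum>w\<in>W. \<Sum>w'\<in>W. fact (card I) * \<mu> * ((if w' = w then 1 else 0) + l))"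
    by (intro sum_mono pair)
  also have "\<dots> = (\<Sum>w\<in>W. fact (card I) * \<mu> * (1 + card W * l))"
    using W(1) by (intro sum.cong refl) (simp add: sum_distrib_left[symmetric] sum.distrib)
  also have "\<dots> = fact (card I) * (1 / (card W * \<mu>) + l / \<mu>) * (card W * \<mu>)\<^sup>2"
    using \<mu> cW by (simp add: power2_eq_square field_simps)
  finally have "card F * (card W * \<mu>)\<^sup>2 \<le> fact (card I) * (1 / (card W * \<mu>) + l / \<mu>) * (card W * \<mu>)\<^sup>2" .
  then show ?thesis using \<mu> cW by (simp add: F_def)
qed

end

section \<open>Polynomial functions\<close>

text \<open>Degree bounds are attached to functions, so that substitution, pinning and division by a
  linear factor become inductions on how a function is built. \<open>d\<close> is only an upper
  bound.\<close>

inductive pdeg :: "nat \<Rightarrow> ((nat \<Rightarrow> 'a::comm_ring_1) \<Rightarrow> 'a) \<Rightarrow> bool" where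
  const: "pdeg d (\<lambda>_. c)"
| add: "pdeg d f \<Longrightarrow> pdeg d g \<Longrightarrow> pdeg d (\<lambda>x. f x + g x)"
| var: "pdeg d f \<Longrightarrow> pdeg (Suc d) (\<lambda>x. x i * f x)"

lemma pdeg_mono:
  assumes "pdeg d f" "d \<le> e"
  shows "pdeg e f"
proof -
  have Suc: "pdeg (Suc d) f" if "pdeg d f" for d and f :: "(nat \<Rightarrow> 'a) \<Rightarrow> 'a"
    using that by induction (auto intro: pdeg.intros)
  show ?thesis using assms(2) by (induction rule: dec_induct) (rule assms(1), rule Suc)
qed

lemma pdeg_scale: "pdeg d f \<Longrightarrow> pdeg d (\<lambda>x. c * f x)"
proof (induction rule: pdeg.induct)
  case (add d f g)
  then show ?case using pdeg.add[of d "\<lambda>x. c * f x" "\<lambda>x. c * g x"] by (simp add: distrib_left)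
next
  case (var d f i)
  then show ?case using pdeg.var[of d "\<lambda>x. c * f x" i] by (simp add: mult.left_commute)
qed (rule pdeg.const)

lemma pdeg_mult:
  assumes "pdeg d f" "pdeg e g"
  shows "pdeg (d + e) (\<lambda>x. f x * g x)"
  using assms(1)
proof (induction rule: pdeg.induct)
  case (const d c)
  then show ?case using pdeg_mono[OF pdeg_scale[OF assms(2), of c]] by simp
next
  case (add d f f')
  then show ?case using pdeg.add[of "d + e"] by (simp add: distrib_right)
next
  case (var d f i)
  then show ?case using pdeg.var[of "d + e" "\<lambda>x. f x * g x" i] by (simp add: mult.assoc)
qed

lemma pdeg_sum: "(\<And>s. s \<in> A \<Longrightarrow> pdeg d (f s)) \<Longrightarrow> pdeg d (\<lambda>x. \<Sum>s\<in>A. f s x)"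
  by (induction A rule: infinite_finite_induct) (auto intro: pdeg.intros)

lemma pdeg_prod:
  "(\<And>s. s \<in> A \<Longrightarrow> pdeg (d s) (f s)) \<Longrightarrow> pdeg (\<Sum>s\<in>A. d s) (\<lambda>x. \<Prod>s\<in>A. f s x)"
  by (induction A rule: infinite_finite_induct) (auto intro: pdeg.const pdeg_mult)

lemma pdeg_coordinate: "pdeg (Suc 0) (\<lambda>x. x i)"
  using pdeg.var[OF pdeg.const[of 0 1], of i] by simp

lemma pdeg_power: "pdeg d f \<Longrightarrow> pdeg (k * d) (\<lambda>x. f x ^ k)"
  by (induction k) (auto intro: pdeg.const pdeg_mult)

lemma pdeg_subst:
  assumes "pdeg d f" and A: "\<And>i. pdeg (Suc 0) (\<lambda>y. A y i)"
  shows "pdeg d (\<lambda>y. f (A y))"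
  using assms(1)
proof (induction rule: pdeg.induct)
  case (var d f i)
  then show ?case using pdeg_mult[OF A[of i]] by simp
qed (auto intro: pdeg.intros)

section \<open>Difference quotients of polynomial functions\<close>

text \<open>A Leibniz rule applied along the construction of \<open>f\<close>. Any affine map
  \<open>A\<close> that moves points by multiples of a fixed vector is allowed, which covers
  transpositions and the fixing of one coordinate. The clause for \<open>d = 0\<close> is there
  because \<open>d - 1\<close> truncates to 0.\<close>

lemma pdeg_difference_quotient:
  assumes "pdeg d f" and A: "\<And>i. pdeg (Suc 0) (\<lambda>y. A y i)"
    and u: "\<And>y i. y i - A y i = u y * \<epsilon> i"
  shows "\<exists>h. pdeg (d - 1) h \<and> (d = 0 \<longrightarrow> h = (\<lambda>_. 0)) \<and> (\<forall>x. f x - f (A x) = u x * h x)"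
  using assms(1)
proof (induction rule: pdeg.induct)
  case (const d c)
  show ?case by (rule exI[of _ "\<lambda>_. 0"]) (auto intro: pdeg.const)
next
  case (add d f g)
  then obtain h h' where h: "pdeg (d - 1) h" "d = 0 \<longrightarrow> h = (\<lambda>_. 0)" "\<And>x. f x - f (A x) = u x * h x"
    "pdeg (d - 1) h'" "d = 0 \<longrightarrow> h' = (\<lambda>_. 0)" "\<And>x. g x - g (A x) = u x * h' x" by blast
  have "f x + g x - (f (A x) + g (A x)) = u x * (h x + h' x)" for x
    unfolding add_diff_add h(3,6) distrib_left ..
  then show ?case using h by (intro exI[of _ "\<lambda>x. h x + h' x"]) (auto intro: pdeg.add)
next
  case (var d f i)
  then obtain h where h: "pdeg (d - 1) h" "d = 0 \<longrightarrow> h = (\<lambda>_. 0)" "\<And>x. f x - f (A x) = u x * h x" by blast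
  \<comment> \<open>For \<open>d = 0\<close> the bound must stay at 0, which holds because
    \<open>h\<close> vanishes.\<close>
  have "pdeg d (\<lambda>x. x i * h x)"
  proof (cases d)
    case 0
    then show ?thesis using h(2) by (simp add: pdeg.const)
  next
    case (Suc e)
    then show ?thesis using pdeg.var[OF h(1), of i] by simp
  qed
  moreover have "pdeg d (\<lambda>x. \<epsilon> i * f (A x))" by (rule pdeg_scale[OF pdeg_subst[OF var.hyps A]])
  ultimately have "pdeg d (\<lambda>x. x i * h x + \<epsilon> i * f (A x))" by (rule pdeg.add)
  moreover have "x i * f x - A x i * f (A x) = u x * (x i * h x + \<epsilon> i * f (A x))" for x
  proof -
    have "x i * f x - A x i * f (A x) = x i * (f x - f (A x)) + (x i - A x i) * f (A x)"
      by (simp add: algebra_simps)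
    then show ?thesis using h(3)[of x] u[of x i] by (simp add: algebra_simps)
  qed
  ultimately show ?case by auto
qed

lemma pdeg_transpose_quotient:
  fixes f :: "(nat \<Rightarrow> 'a::comm_ring_1) \<Rightarrow> 'a"
  assumes "pdeg d f" "i \<noteq> j"
  obtains h where "pdeg (d - 1) h" "d = 0 \<Longrightarrow> h = (\<lambda>_. 0)"
    "\<And>x. f x - f (x \<circ> transpose i j) = (x i - x j) * h x"
proof -
  have "pdeg (Suc 0) (\<lambda>x. (x \<circ> transpose i j) k :: 'a)" for k
    unfolding o_apply by (rule pdeg_coordinate)
  moreover have "x k - (x \<circ> transpose i j) k = (x i - x j) * (if k = i then 1 else if k = j then -1 else 0)"
    for x :: "nat \<Rightarrow> 'a" and k
    using assms(2) by auto
  ultimately have "\<exists>h. pdeg (d - 1) h \<and> (d = 0 \<longrightarrow> h = (\<lambda>_. 0))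
      \<and> (\<forall>x. f x - f (x \<circ> transpose i j) = (x i - x j) * h x)"
    by (rule pdeg_difference_quotient[OF assms(1)])
  then show ?thesis using that by blast
qed

lemma pdeg_fun_upd: "pdeg (Suc 0) (\<lambda>x. (x(l := a)) k)"
  by (cases "k = l") (auto intro: pdeg.const pdeg_coordinate)

lemma pdeg_upd_quotient:
  fixes f :: "(nat \<Rightarrow> 'a::comm_ring_1) \<Rightarrow> 'a"
  assumes "pdeg d f"
  obtains h where "pdeg (d - 1) h" "d = 0 \<Longrightarrow> h = (\<lambda>_. 0)"
    "\<And>x. f x - f (x(l := a)) = (x l - a) * h x"
proof -
  have "x k - (x(l := a)) k = (x l - a) * (if k = l then 1 else 0)" for x :: "nat \<Rightarrow> 'a" and k
    by auto
  then have "\<exists>h. pdeg (d - 1) h \<and> (d = 0 \<longrightarrow> h = (\<lambda>_. 0)) \<and> (\<forall>x. f x - f (x(l := a)) = (x l - a) * h x)"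
    by (rule pdeg_difference_quotient[OF assms pdeg_fun_upd])
  then show ?thesis using that by blast
qed

lemma pdeg_mpoly_eval: "pdeg (total_degree P) (mpoly_eval P)"
proof -
  have mon: "pdeg (monom_degree m) (\<lambda>a. \<Prod>i\<in>Poly_Mapping.keys m. a i ^ Poly_Mapping.lookup m i)" for m
    unfolding monom_degree_def
  proof (rule pdeg_prod)
    fix i
    show "pdeg (Poly_Mapping.lookup m i) (\<lambda>a. a i ^ Poly_Mapping.lookup m i)"
      using pdeg_power[OF pdeg_coordinate[of i], of "Poly_Mapping.lookup m i"] by simp
  qed
  show ?thesis unfolding mpoly_eval_def[abs_def]
  proof (rule pdeg_sum)
    fix m assume "m \<in> Poly_Mapping.keys P"
    then have "monom_degree m \<le> total_degree P"
      unfolding total_degree_def by (intro Max_ge) auto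
    with mon show "pdeg (total_degree P) (\<lambda>a. Poly_Mapping.lookup P m
        * (\<Prod>i\<in>Poly_Mapping.keys m. a i ^ Poly_Mapping.lookup m i))"
      by (rule pdeg_scale[OF pdeg_mono])
  qed
qed

section \<open>Pinned coordinates and the crude density bound on slices\<close>

lemma bij_betw_slice_pin:
  assumes "finite I" "i \<in> I" "k \<sigma> > 0"
  shows "bij_betw (\<lambda>y. y(i := \<sigma>)) (slice (I - {i}) (k(\<sigma> := k \<sigma> - 1))) {x \<in> slice I k. x i = \<sigma>}"
\<comment> \<open>Extensional points are \<open>undefined\<close> off their index set, so unpinning
  \<open>i\<close> resets it to that value.\<close>
proof (rule bij_betw_byWitness[where f' = "\<lambda>x. x(i := undefined)"])
  have split: "card {u \<in> I. x u = c} = card {u \<in> I - {i}. x u = c} + (if x i = c then 1 else 0)" for x c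
  proof (cases "x i = c")
    case True
    then have "{u \<in> I. x u = c} = insert i {u \<in> I - {i}. x u = c}" using assms by auto
    then show ?thesis using assms(1) True by simp
  next
    case False
    then have "{u \<in> I. x u = c} = {u \<in> I - {i}. x u = c}" by auto
    then show ?thesis using False by simp
  qed
  have upd: "{u \<in> I - {i}. (x(i := a)) u = c} = {u \<in> I - {i}. x u = c}" for x a c by auto
  show "\<forall>y\<in>slice (I - {i}) (k(\<sigma> := k \<sigma> - 1)). (y(i := \<sigma>))(i := undefined) = y"
    by (auto simp: slice_def PiE_def extensional_def fun_eq_iff)
  show "\<forall>x\<in>{x \<in> slice I k. x i = \<sigma>}. (x(i := undefined))(i := \<sigma>) = x"
    by (auto simp: fun_eq_iff)
  show "(\<lambda>y. y(i := \<sigma>)) ` slice (I - {i}) (k(\<sigma> := k \<sigma> - 1)) \<subseteq> {x \<in> slice I k. x i = \<sigma>}"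
  proof (rule image_subsetI)
    fix y assume y: "y \<in> slice (I - {i}) (k(\<sigma> := k \<sigma> - 1))"
    have "card {u \<in> I. (y(i := \<sigma>)) u = c} = k c" for c
      unfolding split upd using y assms(3) by (auto simp: slice_def)
    moreover have "y(i := \<sigma>) \<in> I \<rightarrow>\<^sub>E UNIV"
      using y assms(2) by (auto simp: slice_def PiE_def extensional_def)
    ultimately show "y(i := \<sigma>) \<in> {x \<in> slice I k. x i = \<sigma>}" by (simp add: slice_def)
  qed
  show "(\<lambda>x. x(i := undefined)) ` {x \<in> slice I k. x i = \<sigma>} \<subseteq> slice (I - {i}) (k(\<sigma> := k \<sigma> - 1))"
  proof (rule image_subsetI)
    fix x assume x: "x \<in> {x \<in> slice I k. x i = \<sigma>}"
    have "card {u \<in> I - {i}. (x(i := undefined)) u = c} = (k(\<sigma> := k \<sigma> - 1)) c" for c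
      unfolding upd using x split[of x c] by (auto simp: slice_def)
    moreover have "x(i := undefined) \<in> (I - {i}) \<rightarrow>\<^sub>E UNIV"
      using x by (auto simp: slice_def PiE_def extensional_def)
    ultimately show "x(i := undefined) \<in> slice (I - {i}) (k(\<sigma> := k \<sigma> - 1))" by (simp add: slice_def)
  qed
qed

text \<open>Double counting of the pairs of a point and a coordinate of colour
  \<open>\<sigma>\<close>: by transposition symmetry every coordinate has this colour equally
  often.\<close>

lemma card_slice_pin:
  fixes k :: "'c::finite \<Rightarrow> nat"
  assumes I: "finite I" "i \<in> I" and k: "k \<sigma> > 0"
  shows "k \<sigma> * card (slice I k) = card I * card (slice (I - {i}) (k(\<sigma> := k \<sigma> - 1)))"
proof -
  have eq: "card {x \<in> slice I k. x j = \<sigma>} = card {x \<in> slice I k. x i = \<sigma>}" if j: "j \<in> I" for j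
  proof (rule bij_betw_same_card[of "\<lambda>x. x \<circ> transpose i j"],
      rule bij_betw_byWitness[where f' = "\<lambda>x. x \<circ> transpose i j"])
    let ?s = "\<lambda>x. x \<circ> transpose i j"
    show "\<forall>x\<in>{x \<in> slice I k. x j = \<sigma>}. ?s (?s x) = x"
      by (intro ballI comp_transpose_involutory)
    show "\<forall>x\<in>{x \<in> slice I k. x i = \<sigma>}. ?s (?s x) = x"
      by (intro ballI comp_transpose_involutory)
    show "?s ` {x \<in> slice I k. x j = \<sigma>} \<subseteq> {x \<in> slice I k. x i = \<sigma>}"
      by (intro image_subsetI CollectI conjI slice_transpose I(2) j) auto
    show "?s ` {x \<in> slice I k. x i = \<sigma>} \<subseteq> {x \<in> slice I k. x j = \<sigma>}"
      by (intro image_subsetI CollectI conjI slice_transpose I(2) j) auto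
  qed
  have "k \<sigma> * card (slice I k) = (\<Sum>x\<in>slice I k. card {j \<in> I. x j = \<sigma>})"
    by (simp add: slice_def)
  also have "\<dots> = (\<Sum>j\<in>I. card {x \<in> slice I k. x j = \<sigma>})"
    using sum.swap_restrict[OF finite_slice[OF I(1), of k] I(1), of "\<lambda>_ _. 1 :: nat" "\<lambda>x j. x j = \<sigma>"] by simp
  also have "\<dots> = card I * card {x \<in> slice I k. x i = \<sigma>}" using eq by simp
  also have "card {x \<in> slice I k. x i = \<sigma>} = card (slice (I - {i}) (k(\<sigma> := k \<sigma> - 1)))"
    using bij_betw_same_card[OF bij_betw_slice_pin[of I i k \<sigma>, OF I k]] by simp
  finally show ?thesis .
qed

lemma card_slice_pin_pair:
  fixes k :: "'c::finite \<Rightarrow> nat"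
  assumes I: "finite I" "i \<in> I" "j \<in> I" "i \<noteq> j" and k: "k \<sigma> > 0" "k \<tau> > 0" "\<sigma> \<noteq> \<tau>"
  shows "k \<sigma> * k \<tau> * card (slice I k)
    = card I * (card I - 1) * card (slice (I - {i} - {j}) (k(\<sigma> := k \<sigma> - 1, \<tau> := k \<tau> - 1)))"
proof -
  define k' where "k' = k(\<sigma> := k \<sigma> - 1)"
  have k': "k' \<tau> = k \<tau>" "k(\<sigma> := k \<sigma> - 1, \<tau> := k \<tau> - 1) = k'(\<tau> := k' \<tau> - 1)"
    using k(3) by (auto simp: k'_def)
  have 1: "k \<sigma> * card (slice I k) = card I * card (slice (I - {i}) k')"
    unfolding k'_def using I k by (intro card_slice_pin) auto
  have 2: "k' \<tau> * card (slice (I - {i}) k') = card (I - {i}) * card (slice (I - {i} - {j}) (k'(\<tau> := k' \<tau> - 1)))"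
    using I k k' by (intro card_slice_pin) auto
  have "k \<sigma> * k \<tau> * card (slice I k) = k \<tau> * (k \<sigma> * card (slice I k))" by simp
  also have "\<dots> = card I * (k' \<tau> * card (slice (I - {i}) k'))" unfolding 1 k' by simp
  also have "\<dots> = card I * (card I - 1) * card (slice (I - {i} - {j}) (k'(\<tau> := k' \<tau> - 1)))"
    unfolding 2 using I by simp
  finally show ?thesis unfolding k'(2) .
qed

lemma slice_pin_pair:
  assumes I: "finite I" "i \<in> I" "j \<in> I" "i \<noteq> j" and k: "k \<sigma> > 0" "k \<tau> > 0" "\<sigma> \<noteq> \<tau>"
  shows "y \<in> slice (I - {i} - {j}) (k(\<sigma> := k \<sigma> - 1, \<tau> := k \<tau> - 1)) \<Longrightarrow> y(j := \<tau>, i := \<sigma>) \<in> slice I k"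
    and "x \<in> slice I k \<Longrightarrow> x i = \<sigma> \<Longrightarrow> x j = \<tau>
      \<Longrightarrow> \<exists>y\<in>slice (I - {i} - {j}) (k(\<sigma> := k \<sigma> - 1, \<tau> := k \<tau> - 1)). x = y(j := \<tau>, i := \<sigma>)"
proof -
  define k' where "k' = k(\<sigma> := k \<sigma> - 1)"
  have k': "k' \<tau> = k \<tau>" "k' \<tau> > 0" "k(\<sigma> := k \<sigma> - 1, \<tau> := k \<tau> - 1) = k'(\<tau> := k' \<tau> - 1)"
    using k by (auto simp: k'_def)
  have j: "finite (I - {i})" "j \<in> I - {i}" using I by auto
  note b1 = bij_betw_slice_pin[of I i k \<sigma>, OF I(1,2) k(1), folded k'_def]
  note b2 = bij_betw_slice_pin[of "I - {i}" j k' \<tau>, OF j k'(2)]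
  show "y(j := \<tau>, i := \<sigma>) \<in> slice I k"
    if "y \<in> slice (I - {i} - {j}) (k(\<sigma> := k \<sigma> - 1, \<tau> := k \<tau> - 1))"
    using bij_betwE[OF b1] bij_betwE[OF b2] that unfolding k'(3) by blast
  show "\<exists>y\<in>slice (I - {i} - {j}) (k(\<sigma> := k \<sigma> - 1, \<tau> := k \<tau> - 1)). x = y(j := \<tau>, i := \<sigma>)"
    if x: "x \<in> slice I k" "x i = \<sigma>" "x j = \<tau>"
  proof -
    obtain z where z: "z \<in> slice (I - {i}) k'" "x = z(i := \<sigma>)"
      using bij_betw_imp_surj_on[OF b1] x by blast
    then have "z j = \<tau>" using x(3) I(4) by simp
    then obtain y where "y \<in> slice (I - {i} - {j}) (k'(\<tau> := k' \<tau> - 1))" "z = y(j := \<tau>)"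
      using bij_betw_imp_surj_on[OF b2] z by blast
    then show ?thesis using z unfolding k'(3) by blast
  qed
qed

text \<open>
  Exchanging two coordinates \<open>i\<close>, \<open>j\<close> in which \<open>f\<close> is not symmetric changes \<open>f\<close> by
  \<open>(x i - x j) * h x\<close> with \<open>h\<close> of lower degree, and \<open>f\<close> is nonzero at one of the two points
  whenever this is nonzero.
\<close>

lemma slice_nonzero_lower_bound:
  fixes f :: "(nat \<Rightarrow> 'a::{field,finite}) \<Rightarrow> 'a"
  assumes "pdeg d f" "finite I" "\<And>\<sigma>. k \<sigma> \<ge> s + d" "card I \<le> N" "s > 0" "\<exists>x\<in>slice I k. f x \<noteq> 0"
  shows "(real s / N) ^ (2 * d) * card (slice I k) \<le> card {x \<in> slice I k. f x \<noteq> 0}"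
  using assms
proof (induction d arbitrary: f I k rule: less_induct)
  case (less d)
  note fin = finite_slice[OF \<open>finite I\<close>, of k]
  obtain w where w: "w \<in> slice I k" "f w \<noteq> 0" using less.prems by blast
  have "card {i \<in> I. w i = 0} \<le> card I" using less.prems(2) by (intro card_mono) auto
  then have sN: "s \<le> N" using less.prems(3)[of 0] less.prems(4) w by (simp add: slice_def)
  then have frac: "0 \<le> real s / N" "real s / N \<le> 1" using less.prems(5) by auto
  show ?case
  proof (cases "\<exists>x\<in>slice I k. \<exists>i\<in>I. \<exists>j\<in>I. f (x \<circ> transpose i j) \<noteq> f x")
    case False
    \<comment> \<open>Transposition invariance and a single nonzero make \<open>f\<close> nonzero on
      the whole slice; \<open>slice_invariant\<close> is about real functions, hence the
      indicator.\<close>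
    have "f x \<noteq> 0" if "x \<in> slice I k" for x
    proof -
      have "(of_bool (f x = 0) :: real) = of_bool (f w = 0)"
      proof (rule slice_invariant[OF less.prems(2) _ that w(1)])
        show "of_bool (f (y \<circ> transpose i j) = 0) = (of_bool (f y = 0) :: real)"
          if "y \<in> slice I k" "i \<in> I" "j \<in> I" for y i j
          using False that by metis
      qed
      then show ?thesis using w by (simp split: if_splits)
    qed
    then have "{x \<in> slice I k. f x \<noteq> 0} = slice I k" by blast
    then show ?thesis using frac by (simp add: mult_left_le_one_le power_le_one)
  next
    case True
    then obtain x0 i j where x0: "x0 \<in> slice I k" and ij: "i \<in> I" "j \<in> I" and neq: "f (x0 \<circ> transpose i j) \<noteq> f x0"
      by blast
    have xij: "x0 i \<noteq> x0 j" using neq comp_transpose_same[of x0 i j] by auto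
    then have "i \<noteq> j" by auto
    then obtain h where h: "pdeg (d - 1) h" "d = 0 \<Longrightarrow> h = (\<lambda>_. 0)"
        "\<And>x. f x - f (x \<circ> transpose i j) = (x i - x j) * h x"
      using pdeg_transpose_quotient[OF less.prems(1)] by blast
    have h0: "h x0 \<noteq> 0" using h(3)[of x0] neq by auto
    have d: "d > 0" using h(2) h0 by (cases d) auto
    \<comment> \<open>Pinning \<open>i\<close> and \<open>j\<close> to the two distinct colours of
      \<open>x0\<close> makes the factor \<open>x i - x j\<close> a nonzero constant and keeps
      \<open>h\<close> nonzero somewhere.\<close>
    define \<sigma> \<tau> where "\<sigma> = x0 i" and "\<tau> = x0 j"
    have st: "\<sigma> \<noteq> \<tau>" using xij by (simp add: \<sigma>_def \<tau>_def)
    have kpos: "k \<sigma> > 0" "k \<tau> > 0" using less.prems(3)[of \<sigma>] less.prems(3)[of \<tau>] d by auto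
    define k2 where "k2 = k(\<sigma> := k \<sigma> - 1, \<tau> := k \<tau> - 1)"
    define I2 where "I2 = I - {i} - {j}"
    note pin = slice_pin_pair[of I i j k \<sigma> \<tau>, OF less.prems(2) ij \<open>i \<noteq> j\<close> kpos st, folded k2_def I2_def]
    define up where "up y = y(j := \<tau>, i := \<sigma>)" for y :: "nat \<Rightarrow> 'a"
    define h2 where "h2 y = h (up y)" for y
    have h2: "pdeg (d - 1) h2"
    proof -
      have "pdeg (Suc 0) (\<lambda>y. up y l)" for l
        unfolding up_def by (cases "l = i"; cases "l = j") (auto intro: pdeg.const pdeg_coordinate)
      then show ?thesis unfolding h2_def[abs_def] by (rule pdeg_subst[OF h(1)])
    qed
    obtain y0 where "y0 \<in> slice I2 k2" "x0 = up y0"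
      using pin(2)[OF x0 \<sigma>_def[symmetric] \<tau>_def[symmetric]] unfolding up_def by blast
    then have "\<exists>y\<in>slice I2 k2. h2 y \<noteq> 0" using h0 unfolding h2_def by blast
    \<comment> \<open>Each colour loses at most one coordinate while the degree bound drops by one,
      so \<open>s\<close> is unchanged.\<close>
    moreover have "k2 c \<ge> s + (d - 1)" for c
      using less.prems(3)[of c] d by (auto simp: k2_def)
    moreover have "card I2 \<le> N"
      using less.prems(4) card_mono[OF less.prems(2), of I2] unfolding I2_def by force
    ultimately have IH: "(real s / N) ^ (2 * (d - 1)) * card (slice I2 k2) \<le> card {y \<in> slice I2 k2. h2 y \<noteq> 0}"
      using d less.prems(2,5) h2 by (intro less.IH) (auto simp: I2_def)
    have "card {y \<in> slice I2 k2. h2 y \<noteq> 0} \<le> card {x \<in> slice I k. f x \<noteq> 0}"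
    proof (rule card_inj_on_le)
      \<comment> \<open>Outside \<open>i\<close> and \<open>j\<close> both candidate points agree
        with \<open>y\<close>, which makes the choice injective.\<close>
      let ?g = "\<lambda>y. if f (up y) \<noteq> 0 then up y else up y \<circ> transpose i j"
      show "finite {x \<in> slice I k. f x \<noteq> 0}" using fin by simp
      show "inj_on ?g {y \<in> slice I2 k2. h2 y \<noteq> 0}"
      proof (rule inj_onI)
        fix y y' assume y: "y \<in> {y \<in> slice I2 k2. h2 y \<noteq> 0}" and y': "y' \<in> {y \<in> slice I2 k2. h2 y \<noteq> 0}"
          and eq: "?g y = ?g y'"
        show "y = y'"
        proof
          fix u
          show "y u = y' u"
          proof (cases "u \<in> I2")
            case False
            then show ?thesis using y y' by (auto simp: slice_def PiE_def extensional_def)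
          next
            case True
            then have u: "u \<noteq> i" "u \<noteq> j" by (auto simp: I2_def)
            then have "?g z u = z u" for z by (auto simp: up_def)
            then show ?thesis using fun_cong[OF eq, of u] by metis
          qed
        qed
      qed
      show "?g ` {y \<in> slice I2 k2. h2 y \<noteq> 0} \<subseteq> {x \<in> slice I k. f x \<noteq> 0}"
      proof (rule image_subsetI)
        fix y assume y: "y \<in> {y \<in> slice I2 k2. h2 y \<noteq> 0}"
        have up: "up y \<in> slice I k" using pin(1) y by (simp add: up_def)
        have "(up y i - up y j) * h (up y) \<noteq> 0"
          using y st \<open>i \<noteq> j\<close> by (simp add: up_def h2_def)
        then have "f (up y) \<noteq> 0 \<or> f (up y \<circ> transpose i j) \<noteq> 0"
          using h(3)[of "up y"] by auto
        then show "?g y \<in> {x \<in> slice I k. f x \<noteq> 0}"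
          using up slice_transpose[OF ij up] by auto
      qed
    qed
    then have 1: "(real s / N) ^ (2 * (d - 1)) * card (slice I2 k2) \<le> card {x \<in> slice I k. f x \<noteq> 0}"
      using IH by linarith
    \<comment> \<open>Pinning two coordinates costs at most the square of \<open>s / N\<close>,
      which explains the exponent \<open>2 * d\<close>.\<close>
    have "(real s / N)\<^sup>2 * card (slice I k) \<le> card (slice I2 k2)"
    proof -
      have "card {i, j} \<le> card I" using less.prems(2) ij by (intro card_mono) auto
      then have cI: "card I \<ge> 2" using \<open>i \<noteq> j\<close> by simp
      have "real (s * s) * card (slice I k) \<le> real (k \<sigma> * k \<tau>) * card (slice I k)"
        using less.prems(3)[of \<sigma>] less.prems(3)[of \<tau>] by (intro mult_right_mono of_nat_mono mult_le_mono) auto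
      also have "\<dots> = real (card I * (card I - 1)) * card (slice I2 k2)"
        unfolding of_nat_mult[symmetric] k2_def I2_def
        by (subst card_slice_pin_pair) (use less.prems(2) ij \<open>i \<noteq> j\<close> kpos st in auto)
      also have "\<dots> \<le> real (N * N) * card (slice I2 k2)"
        using less.prems(4) by (intro mult_right_mono of_nat_mono mult_le_mono) auto
      finally show ?thesis using cI less.prems(4)
        by (simp add: power2_eq_square field_simps)
    qed
    then have "(real s / N) ^ (2 * (d - 1)) * ((real s / N)\<^sup>2 * card (slice I k))
        \<le> (real s / N) ^ (2 * (d - 1)) * card (slice I2 k2)"
      using frac by (intro mult_left_mono) auto
    moreover have "(real s / N) ^ (2 * d) = (real s / N) ^ (2 * (d - 1)) * (real s / N)\<^sup>2"
    proof -
      have "2 * d = 2 * (d - 1) + 2" using d by simp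
      then show ?thesis by (metis power_add)
    qed
    ultimately show ?thesis using 1 by (simp add: mult.assoc)
  qed
qed

section \<open>The function \<open>delta\<close> and nonzeros on the full grid\<close>

lemma delta_nonneg: "q \<ge> 2 \<Longrightarrow> delta q d \<ge> 0"
proof -
  assume "q \<ge> 2"
  then have "d mod (q - 1) < q - 1" by (intro mod_less_divisor) auto
  then have "real (d mod (q - 1)) \<le> real q" by linarith
  then have "real (d mod (q - 1)) / q \<le> 1" using \<open>q \<ge> 2\<close> by (subst divide_le_eq_1_pos) auto
  then show ?thesis by (simp add: delta_def Let_def)
qed

lemma delta_le_powr: "q \<ge> 2 \<Longrightarrow> delta q d \<le> real q powr (- real (d div (q - 1)))"
  by (simp add: delta_def Let_def mult_left_le_one_le)

text \<open>The recursion for counting nonzeros along one coordinate. Let \<open>\<alpha>\<close>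
  and \<open>\<beta>\<close> be quotient and remainder of \<open>d\<close> by \<open>q - 1\<close>.
  For \<open>t \<le> \<beta>\<close> the quotient stays and the gain is a multiple of
  \<open>t * (\<beta> - t)\<close>; otherwise one unit of \<open>\<alpha>\<close> is borrowed and
  the gain is a multiple of \<open>(q - t - 1) * (t - \<beta>)\<close>.\<close>

lemma delta_step:
  assumes q: "q \<ge> 2" and t: "t \<le> d" "t < q"
  shows "real q * delta q d \<le> (real q - t) * delta q (d - t)"
proof -
  define \<alpha> \<beta> where "\<alpha> = d div (q - 1)" and "\<beta> = d mod (q - 1)"
  have d: "d = \<alpha> * (q - 1) + \<beta>" by (simp only: \<alpha>_def \<beta>_def div_mult_mod_eq)
  have \<beta>: "\<beta> < q - 1" using q by (simp add: \<beta>_def)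
  have q0: "real q > 0" using q by simp
  show ?thesis
  proof (cases "t \<le> \<beta>")
    case True
    then have e: "d - t = (\<beta> - t) + \<alpha> * (q - 1)" using d by simp
    have "(d - t) div (q - 1) = \<alpha>" "(d - t) mod (q - 1) = \<beta> - t"
      using \<beta> unfolding e by (simp_all only: div_mult_self1 mod_mult_self1) auto
    then have D: "delta q (d - t) = (1 - (real \<beta> - t) / q) * real q powr (- real \<alpha>)"
      using True by (simp add: delta_def Let_def of_nat_diff)
    have "real q * (1 - \<beta> / q) \<le> (real q - t) * (1 - (real \<beta> - t) / q)"
    proof -
      have "(real q - t) * (1 - (real \<beta> - t) / q) - real q * (1 - \<beta> / q) = t * (real \<beta> - t) / q"
        using q0 by (simp add: field_simps)
      moreover have "t * (real \<beta> - t) / q \<ge> 0" using True by simp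
      ultimately show ?thesis by linarith
    qed
    then have "real q * (1 - \<beta> / q) * real q powr (- real \<alpha>) \<le> (real q - t) * (1 - (real \<beta> - t) / q) * real q powr (- real \<alpha>)"
      by (rule mult_right_mono) simp
    then show ?thesis unfolding D by (simp add: delta_def Let_def \<alpha>_def \<beta>_def mult.assoc)
  next
    case False
    then have "\<alpha> \<noteq> 0" using d t by (cases "\<alpha> = 0") auto
    then obtain \<alpha>' where \<alpha>': "\<alpha> = Suc \<alpha>'" by (cases \<alpha>) auto
    have e: "d - t = (q - 1 + \<beta> - t) + \<alpha>' * (q - 1)" using d \<alpha>' False t by simp
    have lt: "q - 1 + \<beta> - t < q - 1" using False t by linarith
    then have "(d - t) div (q - 1) = \<alpha>'" "(d - t) mod (q - 1) = q - 1 + \<beta> - t"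
      using q unfolding e by (simp_all only: div_mult_self1 mod_mult_self1) auto
    moreover have "real (q - 1 + \<beta> - t) = real q - 1 + \<beta> - t" using t q by (simp add: of_nat_diff)
    ultimately have D: "delta q (d - t) = (1 - (real q - 1 + \<beta> - t) / q) * real q powr (- real \<alpha>')"
      by (simp add: delta_def Let_def)
    have P: "real q powr (- real \<alpha>') = real q * real q powr (- real \<alpha>)"
      using q0 powr_add[of "real q" 1 "- real \<alpha>"] by (simp add: \<alpha>')
    have "real q * (1 - \<beta> / q) \<le> (real q - t) * (1 - (real q - 1 + \<beta> - t) / q) * q"
    proof -
      have "(real q - t) * (1 - (real q - 1 + \<beta> - t) / q) * q - real q * (1 - \<beta> / q) = (real q - t - 1) * (real t - \<beta>)"
        using q0 by (simp add: field_simps)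
      moreover have "(real q - t - 1) * (real t - \<beta>) \<ge> 0" using False t by (intro mult_nonneg_nonneg) auto
      ultimately show ?thesis by linarith
    qed
    then have "real q * (1 - \<beta> / q) * real q powr (- real \<alpha>)
        \<le> (real q - t) * (1 - (real q - 1 + \<beta> - t) / q) * q * real q powr (- real \<alpha>)"
      by (rule mult_right_mono) simp
    then show ?thesis unfolding D P by (simp add: delta_def Let_def \<alpha>_def \<beta>_def mult.assoc)
  qed
qed

text \<open>Linear factors are divided out one root at a time. A root \<open>a\<close> not yet
  treated remains a root of the quotient, as the earlier factors are nonzero at \<open>a\<close>;
  the degree bound cannot run out, since \<open>f\<close> has a nonzero.\<close>

lemma pdeg_factor:
  fixes f :: "(nat \<Rightarrow> 'a::field) \<Rightarrow> 'a"
  assumes f: "pdeg d f" and "finite A"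
    and zero: "\<And>a y. a \<in> A \<Longrightarrow> y \<in> Y \<Longrightarrow> f (y(l := a)) = 0"
    and nz: "\<exists>y\<in>Y. \<exists>b. f (y(l := b)) \<noteq> 0"
  shows "card A \<le> d \<and> (\<exists>h. pdeg (d - card A) h \<and> (\<forall>y\<in>Y. \<forall>b. f (y(l := b)) = (\<Prod>a\<in>A. b - a) * h (y(l := b))))"
  using assms(2) zero
proof (induction A rule: finite_induct)
  case empty
  then show ?case using f by auto
next
  case (insert a A)
  have "card A \<le> d \<and> (\<exists>h. pdeg (d - card A) h \<and> (\<forall>y\<in>Y. \<forall>b. f (y(l := b)) = (\<Prod>a\<in>A. b - a) * h (y(l := b))))"
    by (rule insert.IH) (rule insert.prems, auto)
  then obtain h where h: "pdeg (d - card A) h" "\<And>y b. y \<in> Y \<Longrightarrow> f (y(l := b)) = (\<Prod>a\<in>A. b - a) * h (y(l := b))"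
    and cA: "card A \<le> d" by blast
  obtain h' where h': "pdeg (d - card A - 1) h'" "d - card A = 0 \<Longrightarrow> h' = (\<lambda>_. 0)"
      "\<And>x. h x - h (x(l := a)) = (x l - a) * h' x"
    using pdeg_upd_quotient[OF h(1), of l a] by blast
  have fact: "f (y(l := b)) = (\<Prod>a\<in>insert a A. b - a) * h' (y(l := b))" if y: "y \<in> Y" for y b
  proof -
    have "(\<Prod>a'\<in>A. a - a') \<noteq> 0" using insert.hyps by auto
    then have "h (y(l := a)) = 0" using h(2)[OF y, of a] insert.prems[of a y] y by simp
    then have "h (y(l := b)) = (b - a) * h' (y(l := b))" using h'(3)[of "y(l := b)"] by simp
    then show ?thesis using h(2)[OF y, of b] insert.hyps by (simp add: mult_ac)
  qed
  have "d - card A \<noteq> 0"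
  proof
    assume "d - card A = 0"
    then have "\<And>y b. y \<in> Y \<Longrightarrow> f (y(l := b)) = 0" using h'(2) fact by simp
    then show False using nz by blast
  qed
  then have "card (insert a A) \<le> d" "d - card A - 1 = d - card (insert a A)" using insert.hyps by simp_all
  then show ?case using fact h'(1) by metis
qed

text \<open>
  Slicing along one coordinate: if \<open>t\<close> of the hyperplanes \<open>x l = a\<close> contain no nonzero, then
  \<open>t\<close> linear factors split off, and the other \<open>q - t\<close> hyperplanes carry functions of degree
  \<open>d - t\<close>.
\<close>

lemma grid_nonzero_lower_bound:
  fixes f :: "(nat \<Rightarrow> 'a::{field,finite}) \<Rightarrow> 'a"
  assumes "finite I" "pdeg d f" "\<exists>x\<in>I \<rightarrow>\<^sub>E UNIV. f x \<noteq> 0"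
  shows "delta CARD('a) d * real (CARD('a) ^ card I) \<le> card {x \<in> I \<rightarrow>\<^sub>E UNIV. f x \<noteq> 0}"
  using assms
proof (induction I arbitrary: f d rule: finite_induct)
  case empty
  have q: "CARD('a) \<ge> 2" using card_mono[of UNIV "{0, 1 :: 'a}"] by simp
  have "delta CARD('a) d \<le> 1"
    using delta_le_powr[OF q, of d] powr_mono[of "- real (d div (CARD('a) - 1))" 0 "real CARD('a)"] q by simp
  moreover have "{x \<in> {} \<rightarrow>\<^sub>E UNIV. f x \<noteq> 0} = {\<lambda>_. undefined}" using empty.prems(2) by auto
  ultimately show ?case by simp
next
  case (insert l I)
  define q where "q = CARD('a)"
  have q: "q \<ge> 2" unfolding q_def using card_mono[of UNIV "{0, 1 :: 'a}"] by simp
  define Y where "Y = I \<rightarrow>\<^sub>E (UNIV :: 'a set)"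
  have finY: "finite Y" unfolding Y_def by (intro finite_PiE insert.hyps) simp
  define A where "A = {a. \<forall>y\<in>Y. f (y(l := a)) = 0}"
  have ext: "insert l I \<rightarrow>\<^sub>E (UNIV :: 'a set) = (\<lambda>(b, y). y(l := b)) ` (UNIV \<times> Y)"
    unfolding Y_def by (rule PiE_insert_eq)
  have nz: "\<exists>y\<in>Y. \<exists>b. f (y(l := b)) \<noteq> 0" using insert.prems(2) unfolding ext by auto
  have "card A \<le> d \<and> (\<exists>h. pdeg (d - card A) h \<and> (\<forall>y\<in>Y. \<forall>b. f (y(l := b)) = (\<Prod>a\<in>A. b - a) * h (y(l := b))))"
    by (rule pdeg_factor[OF insert.prems(1) finite _ nz]) (unfold A_def, blast)
  then obtain h where cA: "card A \<le> d" and h: "pdeg (d - card A) h"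
    "\<And>y b. y \<in> Y \<Longrightarrow> f (y(l := b)) = (\<Prod>a\<in>A. b - a) * h (y(l := b))" by blast
  have "A \<noteq> UNIV" using nz by (auto simp: A_def)
  then have Aq: "card A < q" unfolding q_def by (intro psubset_card_mono) auto
  define C where "C b = {y \<in> Y. f (y(l := b)) \<noteq> 0}" for b
  have C: "delta q (d - card A) * real (q ^ card I) \<le> card (C b)" if b: "b \<notin> A" for b
  proof -
    have eq: "f (y(l := b)) \<noteq> 0 \<longleftrightarrow> h (y(l := b)) \<noteq> 0" if "y \<in> Y" for y
      unfolding h(2)[OF that] using b by auto
    have "pdeg (d - card A) (\<lambda>y. h (y(l := b)))" by (rule pdeg_subst[OF h(1) pdeg_fun_upd])
    moreover have "\<exists>y\<in>Y. h (y(l := b)) \<noteq> 0" using b eq by (auto simp: A_def)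
    ultimately have "delta q (d - card A) * real (q ^ card I) \<le> card {y \<in> Y. h (y(l := b)) \<noteq> 0}"
      unfolding Y_def q_def by (rule insert.IH)
    also have "{y \<in> Y. h (y(l := b)) \<noteq> 0} = C b" using eq by (auto simp: C_def)
    finally show ?thesis .
  qed
  have "delta q d * real (q ^ card (insert l I)) = (q * delta q d) * real (q ^ card I)"
    using insert.hyps by simp
  \<comment> \<open>\<open>delta_step\<close> with \<open>t = card A\<close> weighs the empty
    hyperplanes against the lower degree on the others.\<close>
  also have "\<dots> \<le> ((real q - card A) * delta q (d - card A)) * real (q ^ card I)"
    using delta_step[OF q cA Aq] by (intro mult_right_mono) auto
  also have "\<dots> = (\<Sum>b\<in>UNIV - A. delta q (d - card A) * real (q ^ card I))"
    using Aq by (simp add: card_Diff_subset q_def of_nat_diff)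
  also have "\<dots> \<le> (\<Sum>b\<in>UNIV - A. real (card (C b)))" using C by (intro sum_mono) auto
  also have "\<dots> \<le> (\<Sum>b\<in>UNIV. real (card (C b)))" by (intro sum_mono2) auto
  also have "\<dots> = real (card (SIGMA b:UNIV. C b))"
    using finY by (subst card_SigmaI) (auto simp: C_def)
  also have "card (SIGMA b:UNIV. C b) = card {x \<in> insert l I \<rightarrow>\<^sub>E UNIV. f x \<noteq> 0}"
  proof (rule bij_betw_same_card)
    have "inj_on (\<lambda>(b, y). y(l := b)) (SIGMA b:UNIV. C b)"
    proof (rule inj_on_subset)
      show "inj_on (\<lambda>(b, y). y(l := b)) (UNIV \<times> Y)"
        unfolding Y_def using insert.hyps(2) by (rule inj_combinator)
    qed (auto simp: C_def)
    moreover have "(\<lambda>(b, y). y(l := b)) ` (SIGMA b:UNIV. C b) = {x \<in> insert l I \<rightarrow>\<^sub>E UNIV. f x \<noteq> 0}"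
      unfolding ext by (auto simp: C_def)
    ultimately show "bij_betw (\<lambda>(b, y). y(l := b)) (SIGMA b:UNIV. C b) {x \<in> insert l I \<rightarrow>\<^sub>E UNIV. f x \<noteq> 0}"
      by (simp add: bij_betw_def)
  qed
  finally show ?case by (simp add: q_def)
qed

section \<open>Embedding a grid into the multislice\<close>

lemma card_field_ge_2: "CARD('a::{field,finite}) \<ge> 2"
  using card_mono[of UNIV "{0, 1 :: 'a}"] by simp

text \<open>Shifting coordinate \<open>l\<close> maps the solutions for one right-hand side
  bijectively to those for another, so the space splits into \<open>CARD('a)\<close> parts of equal
  size.\<close>

lemma card_hyperplane:
  fixes c :: "nat \<Rightarrow> 'a::{field,finite}"
  assumes l: "l < r" "c l \<noteq> 0"
  shows "card {p \<in> {..<r} \<rightarrow>\<^sub>E UNIV. (\<Sum>i<r. c i * p i) = s} = CARD('a) ^ (r - 1)"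
proof -
  define H where "H s = {p \<in> {..<r} \<rightarrow>\<^sub>E (UNIV :: 'a set). (\<Sum>i<r. c i * p i) = s}" for s
  have fin: "finite ({..<r} \<rightarrow>\<^sub>E (UNIV :: 'a set))" by (intro finite_PiE) auto
  have upd: "(\<Sum>i<r. c i * (p(l := p l + b)) i) = (\<Sum>i<r. c i * p i) + c l * b" for p b
  proof -
    have "(\<Sum>i<r. c i * (p(l := p l + b)) i) = (\<Sum>i<r. c i * p i + (if i = l then c l * b else 0))"
      by (intro sum.cong refl) (auto simp: algebra_simps)
    then show ?thesis using l by (simp add: sum.distrib)
  qed
  have ext: "p(l := a) \<in> {..<r} \<rightarrow>\<^sub>E (UNIV :: 'a set)" if "p \<in> {..<r} \<rightarrow>\<^sub>E UNIV" for p a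
    using that l by (auto simp: PiE_def extensional_def)
  have const: "card (H s') = card (H s)" for s'
  proof (rule bij_betw_same_card, rule bij_betw_byWitness[where f' = "\<lambda>p. p(l := p l + (s' - s) / c l)"])
    show "(\<lambda>p. p(l := p l + (s - s') / c l)) ` H s' \<subseteq> H s"
      using l by (intro image_subsetI) (simp only: H_def mem_Collect_eq upd ext, simp)
    show "(\<lambda>p. p(l := p l + (s' - s) / c l)) ` H s \<subseteq> H s'"
      using l by (intro image_subsetI) (simp only: H_def mem_Collect_eq upd ext, simp)
  qed (use l in \<open>auto simp: fun_eq_iff field_simps\<close>)
  have "CARD('a) * card (H s) = (\<Sum>s'\<in>(UNIV :: 'a set). card (H s))" by simp
  also have "\<dots> = (\<Sum>s'\<in>UNIV. card (H s'))" by (intro sum.cong refl const[symmetric])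
  also have "\<dots> = card (\<Union>s'\<in>UNIV. H s')"
    using fin by (intro card_UN_disjoint[symmetric]) (auto simp: H_def)
  also have "(\<Union>s'\<in>UNIV. H s') = {..<r} \<rightarrow>\<^sub>E UNIV" by (auto simp: H_def)
  also have "card ({..<r} \<rightarrow>\<^sub>E (UNIV :: 'a set)) = CARD('a) * CARD('a) ^ (r - 1)"
    using l by (cases r) (auto simp: card_PiE)
  finally show ?thesis by (simp add: H_def)
qed

text \<open>
  The coordinates of \<open>embedding_value w\<close> are all affine forms \<open>c + \<langle>w, p\<rangle>\<close>, each with
  multiplicity \<open>K\<close>, plus \<open>R\<close> constant coordinates of every colour. Distinct affine forms make
  the points belonging to distinct \<open>w\<close> pairwise equidistributed.
\<close>

fun embedding_value :: "nat \<Rightarrow> (nat \<Rightarrow> 'a::comm_ring_1) \<Rightarrow> ((nat \<Rightarrow> 'a) \<times> nat \<times> 'a) + (nat \<times> 'a) \<Rightarrow> 'a" where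
  "embedding_value r w (Inl (p, k, c)) = c + (\<Sum>i<r. w i * p i)"
| "embedding_value r w (Inr (k, c)) = c"

definition embedding_index :: "nat \<Rightarrow> nat \<Rightarrow> nat \<Rightarrow> (((nat \<Rightarrow> 'a) \<times> nat \<times> 'a) + (nat \<times> 'a)) set" where
  "embedding_index r K R = (({..<r} \<rightarrow>\<^sub>E UNIV) \<times> {..<K} \<times> UNIV) <+> ({..<R} \<times> UNIV)"

lemma finite_embedding_index: "finite (embedding_index r K R :: (((nat \<Rightarrow> 'a::finite) \<times> nat \<times> 'a) + (nat \<times> 'a)) set)"
  unfolding embedding_index_def by (intro finite_Plus finite_cartesian_product finite_PiE) auto

lemma card_embedding_index:
  "card (embedding_index r K R :: (((nat \<Rightarrow> 'a::finite) \<times> nat \<times> 'a) + (nat \<times> 'a)) set)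
    = CARD('a) * (K * CARD('a) ^ r + R)"
  unfolding embedding_index_def
  by (subst card_Plus) (auto simp: card_cartesian_product card_PiE algebra_simps intro!: finite_PiE finite_cartesian_product)

text \<open>For the affine forms, the two values prescribe
  \<open>\<langle>w' - w, p\<rangle> = \<tau> - \<sigma>\<close>, a hyperplane because
  \<open>w \<noteq> w'\<close>, and then determine \<open>c\<close>. The constant coordinates agree
  at \<open>w\<close> and \<open>w'\<close>, so they count only for
  \<open>\<sigma> = \<tau>\<close>.\<close>

lemma card_embedding_pair:
  fixes w w' :: "nat \<Rightarrow> 'a::{field,finite}"
  assumes w: "w \<in> {..<r} \<rightarrow>\<^sub>E UNIV" "w' \<in> {..<r} \<rightarrow>\<^sub>E UNIV" "w \<noteq> w'"
  shows "card {u \<in> embedding_index r K R. embedding_value r w u = \<sigma> \<and> embedding_value r w' u = \<tau>}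
    = K * CARD('a) ^ (r - 1) + (if \<sigma> = \<tau> then R else 0)"
proof -
  obtain l where l: "l < r" "w l \<noteq> w' l"
    using w by (auto simp: PiE_def extensional_def fun_eq_iff) metis
  define H where "H = {p \<in> {..<r} \<rightarrow>\<^sub>E (UNIV :: 'a set). (\<Sum>i<r. (w' i - w i) * p i) = \<tau> - \<sigma>}"
  define g where "g p = \<sigma> - (\<Sum>i<r. w i * p i)" for p
  define L where "L = (\<lambda>(p, k). (p, k, g p)) ` (H \<times> {..<K})"
  define Q where "Q = (if \<sigma> = \<tau> then {..<R} \<times> {\<sigma>} else {})"
  have cH: "card H = CARD('a) ^ (r - 1)"
    unfolding H_def using l by (intro card_hyperplane) auto
  have diff: "(\<Sum>i<r. (w' i - w i) * p i) = (\<Sum>i<r. w' i * p i) - (\<Sum>i<r. w i * p i)" for p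
    by (simp add: left_diff_distrib sum_subtractf)
  have arith: "b - a = \<tau> - \<sigma> \<and> c = \<sigma> - a \<longleftrightarrow> c + a = \<sigma> \<and> c + b = \<tau>" for a b c :: 'a
  proof
    show "c + a = \<sigma> \<and> c + b = \<tau>" if "b - a = \<tau> - \<sigma> \<and> c = \<sigma> - a" using that by algebra
    show "b - a = \<tau> - \<sigma> \<and> c = \<sigma> - a" if "c + a = \<sigma> \<and> c + b = \<tau>" using that by auto
  qed
  have "{u \<in> embedding_index r K R. embedding_value r w u = \<sigma> \<and> embedding_value r w' u = \<tau>} = L <+> Q"
  proof (intro set_eqI)
    fix u :: "((nat \<Rightarrow> 'a) \<times> nat \<times> 'a) + (nat \<times> 'a)"
    show "u \<in> {u \<in> embedding_index r K R. embedding_value r w u = \<sigma> \<and> embedding_value r w' u = \<tau>} \<longleftrightarrow> u \<in> L <+> Q"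
    proof (cases u)
      case (Inl a)
      obtain p k c where a: "a = (p, k, c)" by (cases a)
      have "a \<in> L \<longleftrightarrow> p \<in> H \<and> k < K \<and> c = g p"
        unfolding L_def a by (auto simp: image_iff)
      also have "\<dots> \<longleftrightarrow> p \<in> {..<r} \<rightarrow>\<^sub>E UNIV \<and> k < K \<and> c + (\<Sum>i<r. w i * p i) = \<sigma> \<and> c + (\<Sum>i<r. w' i * p i) = \<tau>"
        unfolding H_def diff g_def using arith by blast
      finally show ?thesis unfolding Inl a embedding_index_def mem_Collect_eq embedding_value.simps
        by (simp add: Plus_def image_iff)
    next
      case (Inr b)
      obtain k c where b: "b = (k, c)" by (cases b)
      show ?thesis unfolding Inr b embedding_index_def mem_Collect_eq embedding_value.simps
        by (auto simp: Plus_def image_iff Q_def)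
    qed
  qed
  moreover have "card (L <+> Q) = card L + card Q"
  proof (rule card_Plus)
    have "finite H"
      by (rule finite_subset[of _ "{..<r} \<rightarrow>\<^sub>E UNIV"]) (auto simp: H_def intro: finite_PiE)
    then show "finite L" unfolding L_def by simp
  qed (auto simp: Q_def)
  moreover have "card L = card H * K"
    unfolding L_def by (subst card_image) (auto simp: inj_on_def card_cartesian_product)
  moreover have "card Q = (if \<sigma> = \<tau> then R else 0)" by (simp add: Q_def card_cartesian_product)
  ultimately show ?thesis using cH by simp
qed

section \<open>Transfer of the grid bound to the multislice\<close>

text \<open>After a permutation that brings some embedded grid point into \<open>S\<close>, the
  pull-back of \<open>f\<close> is nonzero on at least a fraction \<open>delta q d\<close> of the
  grid. Over all permutations each grid point is uniform on \<open>\<Omega>\<close>, so this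
  fraction bounds \<open>\<mu>\<close> up to the share of the remaining permutations.\<close>

lemma slice_nonzero_probability_ge:
  fixes f :: "(nat \<Rightarrow> 'a::{field,finite}) \<Rightarrow> 'a" and K r R d :: nat and l :: real
  defines "q \<equiv> CARD('a)"
  defines "m \<equiv> K * q ^ r + R"
  defines "n \<equiv> q * m"
  defines "\<Omega> \<equiv> slice {..<n} (\<lambda>_ :: 'a. m)"
  defines "S \<equiv> {x \<in> \<Omega>. f x \<noteq> 0}"
  defines "\<mu> \<equiv> real (card S) / card \<Omega>"
  assumes f: "pdeg d f" and S: "S \<noteq> {}" and r: "r > 0" and K: "K > 0"
    and l: "l \<ge> 0" "l ^ 8 = 2 * n * (2 * real q ^ 3 * (sqrt m + R) / m) ^ 4"
  shows "\<mu> \<ge> delta q d - (1 / (q ^ r * \<mu>) + l / \<mu>)"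
proof -
  have q: "q \<ge> 2" unfolding q_def by (rule card_field_ge_2)
  define M where "M = K * q ^ (r - 1)"
  have m: "m = q * M + R" using r unfolding m_def M_def by (cases r) auto
  define t where "t = (\<lambda>\<sigma> \<tau> :: 'a. M + (if \<sigma> = \<tau> then R else 0))"
  have m_pos: "m > 0" using K q by (simp add: m_def)
  \<comment> \<open>Joint classes of two embedded points have \<open>M\<close> or
    \<open>M + R\<close> elements. With \<open>v\<close> computed from \<open>M\<close> alone, the
    error is at most \<open>R * (2 * M + R) / m\<close>, which is at most \<open>R\<close> as
    \<open>q \<ge> 2\<close>.\<close>
  interpret pair_type "{..<n}" t m "(real M)\<^sup>2 / m" "real R" "real q"
  proof
    show "(\<Sum>\<tau>\<in>UNIV. t \<sigma> \<tau>) = m" for \<sigma> by (simp add: t_def m q_def sum.distrib)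
    show "\<bar>real (t \<sigma> \<tau>) * real (t \<tau> \<upsilon>) / real m - (real M)\<^sup>2 / real m\<bar> \<le> real R" for \<sigma> \<tau> \<upsilon>
    proof -
      have "M * M \<le> t \<sigma> \<tau> * t \<tau> \<upsilon>" "t \<sigma> \<tau> * t \<tau> \<upsilon> \<le> (M + R) * (M + R)"
        by (intro mult_le_mono; simp add: t_def)+
      then have "0 \<le> real (t \<sigma> \<tau>) * real (t \<tau> \<upsilon>) - (real M)\<^sup>2"
        "real (t \<sigma> \<tau>) * real (t \<tau> \<upsilon>) \<le> (real M + real R) * (real M + real R)"
        by (simp_all add: power2_eq_square flip: of_nat_mult of_nat_add)
      moreover have "(real M + real R) * (real M + real R) - (real M)\<^sup>2 \<le> R * m"
      proof -
        have "real (2 * M) \<le> real (q * M)" using q by (intro of_nat_mono mult_le_mono) auto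
        then have "real R * (2 * real M + R) \<le> real R * m" unfolding m by (intro mult_left_mono) auto
        then show ?thesis by (simp add: power2_eq_square algebra_simps)
      qed
      ultimately have "\<bar>real (t \<sigma> \<tau>) * real (t \<tau> \<upsilon>) - (real M)\<^sup>2\<bar> \<le> R * m" by linarith
      then show ?thesis using m_pos by (simp add: diff_divide_distrib[symmetric] abs_divide field_simps)
    qed
  qed (use m_pos in \<open>auto simp: t_def q_def\<close>)
  define W where "W = {..<r} \<rightarrow>\<^sub>E (UNIV :: 'a set)"
  have finW: "finite W" unfolding W_def by (intro finite_PiE) auto
  have cW: "card W = q ^ r" by (simp add: W_def q_def card_PiE)
  have "card (embedding_index r K R :: (((nat \<Rightarrow> 'a) \<times> nat \<times> 'a) + (nat \<times> 'a)) set) = card {..<n}"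
    by (simp add: card_embedding_index n_def m_def q_def)
  then obtain \<beta> :: "nat \<Rightarrow> ((nat \<Rightarrow> 'a) \<times> nat \<times> 'a) + (nat \<times> 'a)"
    where \<beta>: "bij_betw \<beta> {..<n} (embedding_index r K R)"
    using finite_same_card_bij[OF finite_lessThan finite_embedding_index] by metis
  define \<Phi> where "\<Phi> w = (\<lambda>i\<in>{..<n}. embedding_value r w (\<beta> i))" for w
  have adj: "adj (\<Phi> w) (\<Phi> w')" if "w \<in> W" "w' \<in> W" "w \<noteq> w'" for w w'
  proof -
    have "card {i \<in> {..<n}. \<Phi> w i = \<sigma> \<and> \<Phi> w' i = \<tau>} = t \<sigma> \<tau>" for \<sigma> \<tau>
    proof -
      have "bij_betw \<beta> {i \<in> {..<n}. \<Phi> w i = \<sigma> \<and> \<Phi> w' i = \<tau>}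
        {u \<in> embedding_index r K R. embedding_value r w u = \<sigma> \<and> embedding_value r w' u = \<tau>}"
      proof (rule bij_betw_subset[OF \<beta>])
        show "\<beta> ` {i \<in> {..<n}. \<Phi> w i = \<sigma> \<and> \<Phi> w' i = \<tau>}
          = {u \<in> embedding_index r K R. embedding_value r w u = \<sigma> \<and> embedding_value r w' u = \<tau>}"
          unfolding bij_betw_imp_surj_on[OF \<beta>, symmetric] by (auto simp: \<Phi>_def)
      qed auto
      then have "card {i \<in> {..<n}. \<Phi> w i = \<sigma> \<and> \<Phi> w' i = \<tau>}
        = card {u \<in> embedding_index r K R. embedding_value r w u = \<sigma> \<and> embedding_value r w' u = \<tau>}"
        by (rule bij_betw_same_card)
      then show ?thesis
        using card_embedding_pair[of w r w' K R \<sigma> \<tau>] that by (simp add: W_def t_def M_def q_def)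
    qed
    then show ?thesis by (auto simp: adj_def \<Phi>_def)
  qed
  \<comment> \<open>Every grid point needs a second one: their adjacency places it in
    \<open>\<Omega>\<close> and makes \<open>deg\<close> positive.\<close>
  have "card W \<ge> 2" unfolding cW using q r self_le_power[of q r] by linarith
  then have other: "\<exists>w'\<in>W. w \<noteq> w'" for w
  proof -
    have "\<not> W \<subseteq> {w}" using card_mono[of "{w}" W] \<open>card W \<ge> 2\<close> by auto
    then show ?thesis by auto
  qed
  obtain w0 where w0: "w0 \<in> W" using \<open>card W \<ge> 2\<close> by fastforce
  have \<Phi>\<Omega>: "\<Phi> w \<in> \<Omega>" if "w \<in> W" for w
    using other[of w] adj that adj_sliceD unfolding \<Omega>_def by blast
  have deg: "deg > 0"
  proof -
    have "nbr (\<Phi> w0) \<noteq> {}" using other[of w0] adj w0 unfolding nbr_def by blast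
    then have "card (nbr (\<Phi> w0)) > 0" using finite_nbr by (simp add: card_gt_0_iff)
    then show ?thesis using card_nbr[OF \<Phi>\<Omega>[OF w0, unfolded \<Omega>_def]] by simp
  qed
  define B where "B = {p. p permutes {..<n} \<and> (\<forall>w\<in>W. \<Phi> w \<circ> p \<notin> S)}"
  have B: "card B \<le> fact n * (1 / (q ^ r * \<mu>) + l / \<mu>)"
    using few_permutations_miss[of S l W \<Phi>, OF deg _ S l(1) _ finW _ _ adj] l(2) S w0 \<Phi>\<Omega> cW
    by (auto simp: B_def \<mu>_def \<Omega>_def S_def \<rho>_def)
  have finp: "finite {p. p permutes {..<n}}" by (rule finite_permutations) simp
  have cp: "card {p. p permutes {..<n}} = fact n" by (simp add: card_permutations)
  have good: "delta q d * real (q ^ r) \<le> (\<Sum>w\<in>W. of_bool (\<Phi> w \<circ> p \<in> S))"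
    if p: "p permutes {..<n}" "p \<notin> B" for p
  proof -
    define F where "F w = f (\<Phi> w \<circ> p)" for w
    have "pdeg d F" unfolding F_def
    proof (rule pdeg_subst[OF f])
      fix i
      show "pdeg (Suc 0) (\<lambda>w. (\<Phi> w \<circ> p) i)"
      proof (cases "p i < n")
        case True
        have "pdeg (Suc 0) (\<lambda>w. embedding_value r w u)" for u :: "((nat \<Rightarrow> 'a) \<times> nat \<times> 'a) + (nat \<times> 'a)"
        proof (cases u)
          case (Inl a)
          obtain v k c where "a = (v, k, c)" by (cases a)
          moreover have "pdeg (Suc 0) (\<lambda>w. c + (\<Sum>i<r. w i * v i))"
            by (intro pdeg.add pdeg.const pdeg_sum pdeg.var)
          ultimately show ?thesis using Inl by simp
        next
          case (Inr b)
          then show ?thesis by (cases b) (simp add: pdeg.const)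
        qed
        then show ?thesis using True by (simp add: \<Phi>_def)
      qed (simp add: \<Phi>_def pdeg.const)
    qed
    moreover have "\<exists>w\<in>W. F w \<noteq> 0" using p by (auto simp: B_def F_def S_def)
    ultimately have "delta q d * real (q ^ r) \<le> card {w \<in> W. F w \<noteq> 0}"
      using grid_nonzero_lower_bound[of "{..<r}" d F] by (simp add: W_def q_def)
    also have "{w \<in> W. F w \<noteq> 0} = W \<inter> {w. \<Phi> w \<circ> p \<in> S}"
      using slice_comp_permutes[OF p(1)] \<Phi>\<Omega> by (auto simp: F_def S_def \<Omega>_def)
    also have "real (card \<dots>) = (\<Sum>w\<in>W. of_bool (\<Phi> w \<circ> p \<in> S))"
      using finW by (simp add: of_bool_def sum.If_cases)
    finally show ?thesis .
  qed
  have "(fact n - real (card B)) * (delta q d * real (q ^ r)) = (\<Sum>p\<in>{p. p permutes {..<n}} - B. delta q d * real (q ^ r))"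
  proof -
    have sub: "B \<subseteq> {p. p permutes {..<n}}" by (auto simp: B_def)
    have "card ({p. p permutes {..<n}} - B) = fact n - card B"
      using card_Diff_subset[OF finite_subset[OF sub finp] sub] unfolding cp .
    moreover have "card B \<le> fact n" using card_mono[OF finp sub] unfolding cp .
    ultimately show ?thesis by (simp add: of_nat_diff)
  qed
  also have "\<dots> \<le> (\<Sum>p\<in>{p. p permutes {..<n}} - B. \<Sum>w\<in>W. of_bool (\<Phi> w \<circ> p \<in> S))"
    using good by (intro sum_mono) auto
  also have "\<dots> \<le> (\<Sum>p | p permutes {..<n}. \<Sum>w\<in>W. of_bool (\<Phi> w \<circ> p \<in> S))"
    using finp by (intro sum_mono2) (auto intro!: sum_nonneg)
  also have "\<dots> = (\<Sum>w\<in>W. \<Sum>p | p permutes {..<n}. of_bool (\<Phi> w \<circ> p \<in> S))" by (rule sum.swap)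
  also have "\<dots> = (\<Sum>w\<in>W. fact n * \<mu>)"
  proof (intro sum.cong refl)
    fix w assume "w \<in> W"
    then have "(\<Sum>p | p permutes {..<n}. of_bool (\<Phi> w \<circ> p \<in> S)) = fact n * (\<Sum>y\<in>\<Omega>. of_bool (y \<in> S)) / card \<Omega>"
      using sum_permutes_slice[OF finite_lessThan, of "\<Phi> w" n "\<lambda>_. m" "\<lambda>x. of_bool (x \<in> S)"] \<Phi>\<Omega>
      by (simp add: \<Omega>_def)
    also have "(\<Sum>y\<in>\<Omega>. of_bool (y \<in> S)) = real (card S)"
      using finite_\<Omega> by (simp add: of_bool_def sum.If_cases S_def \<Omega>_def Int_def)
    finally show "(\<Sum>p | p permutes {..<n}. of_bool (\<Phi> w \<circ> p \<in> S)) = fact n * \<mu>"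
      unfolding \<mu>_def times_divide_eq_right .
  qed
  also have "\<dots> = fact n * \<mu> * real (q ^ r)" using cW by simp
  finally have "((fact n - real (card B)) * delta q d) * real (q ^ r) \<le> (fact n * \<mu>) * real (q ^ r)"
    by (simp only: mult.assoc)
  then have "(fact n - real (card B)) * delta q d \<le> fact n * \<mu>"
    using q by (subst (asm) mult_le_cancel_right_pos) auto
  moreover have "real (card B) * delta q d \<le> fact n * (1 / (q ^ r * \<mu>) + l / \<mu>) * 1"
  proof (rule mult_mono[OF B])
    show "delta q d \<le> 1"
      using delta_le_powr[OF q, of d] powr_mono[of "- real (d div (q - 1))" 0 "real q"] q by simp
    show "0 \<le> delta q d" using q by (rule delta_nonneg)
    have "\<mu> \<ge> 0" by (simp add: \<mu>_def)
    then show "0 \<le> fact n * (1 / (q ^ r * \<mu>) + l / \<mu>)" using l(1) by simp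
  qed
  ultimately have "fact n * delta q d \<le> fact n * (\<mu> + (1 / (q ^ r * \<mu>) + l / \<mu>))"
    by (simp add: algebra_simps)
  then have "delta q d \<le> \<mu> + (1 / (q ^ r * \<mu>) + l / \<mu>)"
    by (subst (asm) mult_le_cancel_left_pos) auto
  then show ?thesis by simp
qed

section \<open>Choice of parameters and conclusion\<close>

lemma balanced_multislice_eq_slice:
  "balanced_multislice (CARD('a) * m) = slice {..<CARD('a) * m} (\<lambda>_ :: 'a::finite. m)"
proof -
  have "real (card A) = real (CARD('a) * m) / real CARD('a) \<longleftrightarrow> card A = m" for A :: "nat set"
    by simp
  then show ?thesis unfolding balanced_multislice_def slice_def by (simp only:)
qed

text \<open>With \<open>X\<close> the 32nd root of \<open>n\<close>, the grid has at least
  \<open>X ^ 8 / q\<close> points, \<open>l\<close> is of order at most \<open>1 / X ^ 4\<close>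
  and, for the degrees considered, \<open>1 / \<mu>\<close> of order at most \<open>X ^ 2\<close>.
  The total error is then at most \<open>C / X ^ 2\<close>, and the lower bound on \<open>n\<close>
  makes it at most \<open>1 / X\<close>.\<close>

lemma slice_nonzero_probability_low_degree:
  fixes f :: "(nat \<Rightarrow> 'a::{field,finite}) \<Rightarrow> 'a" and d m :: nat
  defines "q \<equiv> CARD('a)"
  defines "n \<equiv> q * m"
  defines "\<Omega> \<equiv> slice {..<n} (\<lambda>_ :: 'a. m)"
  defines "S \<equiv> {x \<in> \<Omega>. f x \<noteq> 0}"
  defines "\<mu> \<equiv> real (card S) / card \<Omega>"
  defines "c \<equiv> 1 / (64 * real q)"
  defines "C \<equiv> (512 * q ^ 14 + q) * q ^ (4 * q)"
  assumes f: "pdeg d f" and S: "S \<noteq> {}"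
    and d: "real q ^ (d div (q - 1)) \<le> real n powr c"
    and n: "(2 * q * C) ^ 32 \<le> n"
  shows "\<mu> \<ge> delta q d - 1 / real n powr c"
proof -
  have q: "q \<ge> 2" unfolding q_def by (rule card_field_ge_2)
  have C1: "C \<ge> q ^ (4 * q)" "C \<ge> 1" using q by (simp_all add: C_def Suc_leI)
  define X where "X = real n powr (1 / 32)"
  have "0 < (2 * q * C) ^ 32" using C1 q by (intro zero_less_power mult_pos_pos) auto
  then have n1: "n \<ge> 1" using n by linarith
  have X32: "X ^ 32 = real n" using n1 by (simp add: X_def powr_realpow[symmetric] powr_powr)
  have X0: "X > 0" using n1 by (simp add: X_def)
  have XC: "2 * real q * real C \<le> X"
  proof (rule power_le_imp_le_base)
    have "real ((2 * q * C) ^ 32) \<le> real n" using n by (rule of_nat_mono)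
    then show "(2 * real q * real C) ^ Suc 31 \<le> X ^ Suc 31" using X32 by simp
  qed (use X0 in simp)
  have "1 * 1 \<le> (2 * real q) * real C" using q C1 by (intro mult_mono) auto
  then have X1: "X \<ge> 1" using XC by simp
  have "1 * real C \<le> (2 * real q) * real C" using q by (intro mult_right_mono) auto
  then have CX: "real C \<le> X" using XC by simp
  have m1: "m \<ge> 1" using n1 by (cases m) (auto simp: n_def)
  have mn: "real m = real n / real q" using q by (simp add: n_def)

  \<comment> \<open>\<open>r\<close> is maximal with \<open>q ^ (4 * r) \<le> n\<close>, so
    \<open>Q = q ^ r\<close> is the fourth root of \<open>n\<close> up to a factor
    \<open>q\<close>.\<close>
  have q1: "q ^ 4 \<ge> 2" using q self_le_power[of q 4] by simp
  obtain r where r: "(q ^ 4) ^ r \<le> n" "n < (q ^ 4) ^ (r + 1)"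
    using ex_power_ivl1[OF q1 n1] by blast
  have r0: "r > 0"
  proof (rule ccontr)
    assume "\<not> r > 0"
    then have "n < q ^ 4" using r(2) by simp
    also have "q ^ 4 \<le> (2 * q * C) ^ 4" using C1 by (intro power_mono) auto
    also have "\<dots> \<le> (2 * q * C) ^ 32" using C1 q by (intro power_increasing) auto
    finally show False using n by simp
  qed
  define Q where "Q = q ^ r"
  have Qq: "q \<le> Q" unfolding Q_def using q r0 by (intro self_le_power) auto
  have Q4: "Q ^ 4 \<le> n" "n < (q * Q) ^ 4"
    using r unfolding Q_def by (simp_all add: power_mult_distrib power_add power_mult[symmetric] mult.commute)
  have Q2: "Q ^ 2 \<le> m"
  proof -
    have "q * Q ^ 2 \<le> Q ^ 2 * Q ^ 2" using Qq q by (intro mult_le_mono) (auto simp: power2_eq_square intro: order_trans)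
    also have "\<dots> = Q ^ 4" by (simp flip: power_add)
    also have "\<dots> \<le> q * m" using Q4(1) by (simp add: n_def)
    finally show ?thesis using q by simp
  qed
  have Qm: "Q \<le> m" using Q2 Qq q by (metis order_trans power2_nat_le_imp_le)
  \<comment> \<open>Since \<open>R < Q \<le> sqrt m\<close>, the leftover coordinates contribute at
    most \<open>sqrt m\<close> to the numerator of \<open>\<rho>\<close>.\<close>
  define K R where "K = m div Q" and "R = m mod Q"
  have Q0: "Q > 0" using Qq q by simp
  have mKR: "m = K * Q + R" by (simp add: K_def R_def)
  have K0: "K > 0" unfolding K_def using Qm Q0 by (simp add: div_greater_zero_iff)
  have "real R \<le> sqrt m"
  proof (rule real_le_rsqrt)
    have "R ^ 2 \<le> Q ^ 2" using Q0 by (intro power_mono) (auto simp: R_def less_imp_le)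
    then have "R ^ 2 \<le> m" using Q2 by linarith
    then show "(real R)\<^sup>2 \<le> real m" by (metis of_nat_le_iff of_nat_power)
  qed
  define \<rho> where "\<rho> = 2 * real q ^ 3 * (sqrt m + R) / m"
  have \<rho>0: "\<rho> \<ge> 0" by (simp add: \<rho>_def)
  have "\<rho> \<le> 2 * real q ^ 3 * (sqrt m + sqrt m) / m"
    unfolding \<rho>_def using \<open>real R \<le> sqrt m\<close> by (intro divide_right_mono mult_left_mono) auto
  also have "\<dots> = 4 * real q ^ 3 / sqrt m"
    using m1 by (simp add: field_simps)
  finally have "\<rho> ^ 4 \<le> (4 * real q ^ 3 / sqrt m) ^ 4" using \<rho>0 by (intro power_mono)
  also have "\<dots> = 256 * real q ^ 12 / (real m)\<^sup>2"
  proof -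
    have "sqrt m ^ 4 = (real m)\<^sup>2" using power_mult[of "sqrt m" 2 2] by simp
    then show ?thesis by (simp add: power_divide power_mult_distrib flip: power_mult)
  qed
  finally have "2 * real n * \<rho> ^ 4 \<le> 2 * real n * (256 * real q ^ 12 / (real m)\<^sup>2)"
    by (intro mult_left_mono) auto
  also have "\<dots> = 512 * (real q * (real q * real q ^ 12)) / n"
    unfolding mn using n1 q by (simp add: power2_eq_square field_simps)
  also have "real q * (real q * real q ^ 12) = real q ^ 14" by (simp flip: power_Suc)
  finally have \<rho>n: "2 * real n * \<rho> ^ 4 \<le> 512 * real q ^ 14 / n" .
  define l where "l = root 8 (2 * real n * \<rho> ^ 4)"
  have l: "l \<ge> 0" "l ^ 8 = 2 * real n * \<rho> ^ 4" using \<rho>0 by (simp_all add: l_def)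
  have l_le: "l \<le> 512 * real q ^ 14 / X ^ 4"
  proof (rule power_le_imp_le_base)
    have "512 * real q ^ 14 \<ge> 1 * 1" using q by (intro mult_mono) (auto intro: one_le_power)
    then have "512 * real q ^ 14 \<le> (512 * real q ^ 14) ^ 8" by (intro self_le_power) auto
    then have "512 * real q ^ 14 / X ^ 32 \<le> (512 * real q ^ 14) ^ 8 / X ^ 32"
      using X0 by (intro divide_right_mono) auto
    also have "\<dots> = (512 * real q ^ 14 / X ^ 4) ^ 8" by (simp add: power_divide flip: power_mult)
    finally show "l ^ Suc 7 \<le> (512 * real q ^ 14 / X ^ 4) ^ Suc 7" using l(2) \<rho>n X32 by simp
  qed (use X0 in simp)
  \<comment> \<open>The grid would allow \<open>q / X ^ 8\<close>; the weaker bound matches the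
    order reached by \<open>l\<close>.\<close>
  have Q_le: "1 / Q \<le> q / X ^ 4"
  proof -
    have "X ^ 8 \<le> real q * Q"
    proof (rule power_le_imp_le_base)
      have "real n \<le> real ((q * Q) ^ 4)" using Q4(2) by (intro of_nat_mono less_imp_le)
      then show "(X ^ 8) ^ Suc 3 \<le> (real q * Q) ^ Suc 3" by (simp add: X32 flip: power_mult)
    qed simp
    moreover have "X ^ 4 \<le> X ^ 8" using X1 by (intro power_increasing) auto
    ultimately have "X ^ 4 \<le> real q * Q" by linarith
    then show ?thesis using X0 Q0 by (simp add: field_simps)
  qed
  have X2: "real n powr (1 / 16) = X ^ 2"
    using X0 n1 by (simp add: X_def powr_realpow[symmetric] powr_powr)
  have pow_d: "real q ^ (4 * d) \<le> real q ^ (4 * q) * X ^ 2"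
  proof -
    define \<alpha> where "\<alpha> = d div (q - 1)"
    have "d = \<alpha> * (q - 1) + d mod (q - 1)" unfolding \<alpha>_def by (simp only: div_mult_mod_eq)
    moreover have "d mod (q - 1) < q - 1" using q by simp
    moreover have "\<alpha> * (q - 1) \<le> \<alpha> * q" by (intro mult_le_mono) auto
    ultimately have "d \<le> \<alpha> * q + q" by linarith
    then have "real q ^ (4 * d) \<le> real q ^ (4 * (\<alpha> * q + q))" using q by (intro power_increasing) auto
    also have "\<dots> = real q ^ (4 * q) * (real q ^ \<alpha>) ^ (4 * q)"
      by (simp add: algebra_simps flip: power_add power_mult)
    also have "\<dots> \<le> real q ^ (4 * q) * (real n powr c) ^ (4 * q)"
      using d unfolding \<alpha>_def by (intro mult_left_mono power_mono) auto
    \<comment> \<open>The choice \<open>c = 1 / (64 * q)\<close> serves this step: the power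
      \<open>4 * q\<close> turns the exponent into \<open>1 / 16\<close>.\<close>
    also have "(real n powr c) ^ (4 * q) = real n powr (1 / 16)"
      using n1 q by (simp add: powr_realpow[symmetric] powr_powr c_def)
    finally show ?thesis unfolding X2 .
  qed
  \<comment> \<open>A degree of at most \<open>m / 2\<close> leaves at least half of every colour
    class through all pinnings.\<close>
  have dm: "2 * d \<le> m"
  proof -
    have "d < 2 ^ d" by (rule less_exp)
    also have "(2::nat) ^ d \<le> q ^ d" using q by (intro power_mono) auto
    also have "q ^ d \<le> q ^ (4 * d)" using q by (intro power_increasing) auto
    finally have "real d \<le> real (q ^ (4 * d))" by (intro of_nat_mono less_imp_le)
    also have "\<dots> \<le> real (q ^ (4 * q)) * X ^ 2" using pow_d by simp
    also have "\<dots> \<le> real C * X ^ 2" using C1 by (intro mult_right_mono of_nat_mono) auto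
    finally have "2 * real q * real d \<le> 2 * real q * (real C * X ^ 2)" by (intro mult_left_mono) auto
    also have "\<dots> = (2 * real q * real C) * X ^ 2" by simp
    also have "\<dots> \<le> X * X ^ 2" using XC by (intro mult_right_mono) auto
    also have "\<dots> = X ^ 3" by (simp add: power2_eq_square power3_eq_cube)
    also have "\<dots> \<le> X ^ 32" using X1 by (intro power_increasing) auto
    also have "\<dots> = real q * real m" by (simp add: X32 n_def)
    finally have "real q * (2 * real d) \<le> real q * real m" by (simp add: mult_ac)
    then show ?thesis using q by simp
  qed
  have fin\<Omega>: "finite \<Omega>" unfolding \<Omega>_def by (rule finite_slice) simp
  then have c\<Omega>: "real (card \<Omega>) > 0" using S by (auto simp: S_def card_gt_0_iff)
  define s where "s = m - d"
  have s: "s > 0" "s + d = m" "2 * s \<ge> m" using dm m1 by (auto simp: s_def)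
  have "(real s / n) ^ (2 * d) * card \<Omega> \<le> card S"
    unfolding S_def \<Omega>_def
  proof (rule slice_nonzero_lower_bound[OF f])
    show "\<exists>x\<in>slice {..<n} (\<lambda>_. m). f x \<noteq> 0" using S unfolding S_def \<Omega>_def by blast
  qed (use s in auto)
  then have \<mu>1: "(real s / n) ^ (2 * d) \<le> \<mu>" using c\<Omega> by (simp add: \<mu>_def field_simps)
  \<comment> \<open>This follows from \<open>n = q * m \<le> 2 * q * s\<close> and
    \<open>2 \<le> q\<close>; raised to \<open>2 * d\<close> it yields
    \<open>q ^ (4 * d)\<close>.\<close>
  have "1 / (real q)\<^sup>2 \<le> real s / n"
  proof -
    have "n \<le> q * q * s"
    proof -
      have "n \<le> q * (2 * s)" using s unfolding n_def by simp
      also have "\<dots> \<le> q * (q * s)" using q by simp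
      finally show ?thesis by simp
    qed
    then have "real n \<le> real (q * q * s)" by (rule of_nat_mono)
    then show ?thesis using n1 q by (simp add: field_simps power2_eq_square)
  qed
  then have "(1 / (real q)\<^sup>2) ^ (2 * d) \<le> (real s / n) ^ (2 * d)" by (intro power_mono) auto
  then have \<mu>2: "1 / real q ^ (4 * d) \<le> \<mu>" using \<mu>1 by (simp add: power_divide flip: power_mult)
  have qd: "real q ^ (4 * d) > 0" using q by simp
  have \<mu>0: "\<mu> > 0" using \<mu>2 qd by (meson less_le_trans zero_less_divide_1_iff)
  have \<mu>3: "1 / \<mu> \<le> real q ^ (4 * q) * X ^ 2"
  proof -
    have "1 / \<mu> \<le> real q ^ (4 * d)" using \<mu>2 \<mu>0 qd by (simp add: field_simps)
    then show ?thesis using pow_d by linarith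
  qed
  have "1 / (Q * \<mu>) + l / \<mu> = (1 / Q + l) * (1 / \<mu>)"
    using \<mu>0 Q0 by (simp add: field_simps)
  also have "\<dots> \<le> (q / X ^ 4 + 512 * real q ^ 14 / X ^ 4) * (real q ^ (4 * q) * X ^ 2)"
    using l(1) \<mu>0 X0 by (intro mult_mono add_mono Q_le l_le \<mu>3) auto
  also have "\<dots> = real C / X ^ 2"
    using X0 by (simp add: C_def field_simps eval_nat_numeral)
  also have "\<dots> \<le> X / X ^ 2" using CX X0 by (intro divide_right_mono) auto
  also have "\<dots> = 1 / X" by (simp add: power2_eq_square)
  also have "\<dots> \<le> 1 / real n powr c"
  proof -
    have "c \<le> 1 / 32" using q by (simp add: c_def field_simps)
    then have "real n powr c \<le> X" unfolding X_def using n1 by (intro powr_mono) auto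
    then show ?thesis using X0 n1 by (intro divide_left_mono) auto
  qed
  finally have err: "1 / (Q * \<mu>) + l / \<mu> \<le> 1 / real n powr c" .
  have "\<mu> \<ge> delta q d - (1 / (q ^ r * \<mu>) + l / \<mu>)"
    using slice_nonzero_probability_ge[of d f K r R l, folded q_def, folded Q_def, folded mKR, folded n_def,
        folded \<Omega>_def, folded S_def, folded \<mu>_def, folded \<rho>_def, OF f S r0 K0 l]
    by (simp add: Q_def)
  then show ?thesis using err by (simp add: Q_def)
qed

theorem theorem1p4:
  fixes q :: nat
  assumes "CARD('a::{field,finite}) = q"
  shows "\<exists>c::real. c > 0 \<and> (\<exists>n\<^sub>0::nat. \<forall>n\<ge>n\<^sub>0. q dvd n \<longrightarrow>
    (\<forall>(d::nat) (P :: 'a mpoly).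
       P \<in> mpoly_ring n \<longrightarrow> total_degree P \<le> d \<longrightarrow>
       (\<exists>a \<in> balanced_multislice n. mpoly_eval P a \<noteq> 0) \<longrightarrow>
       measure_pmf.prob (pmf_of_set (balanced_multislice n)) {b. mpoly_eval P b \<noteq> 0}
         \<ge> delta q d - 1 / real n powr c))"
proof -
  have q: "q \<ge> 2" unfolding assms[symmetric] by (rule card_field_ge_2)
  \<comment> \<open>Both constants are those of \<open>slice_nonzero_probability_low_degree\<close>
    and depend on \<open>q\<close> only.\<close>
  define c where "c = 1 / (64 * real q)"
  define n\<^sub>0 where "n\<^sub>0 = (2 * q * ((512 * q ^ 14 + q) * q ^ (4 * q))) ^ 32"
  have "delta q d - 1 / real n powr c
      \<le> measure_pmf.prob (pmf_of_set (balanced_multislice n)) {b. mpoly_eval P b \<noteq> 0}"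
    if n: "n\<^sub>0 \<le> n" "q dvd n" and P: "total_degree P \<le> d" and nz: "\<exists>a \<in> balanced_multislice n. mpoly_eval P a \<noteq> 0"
    for n d and P :: "'a mpoly"
  proof (cases "real q ^ (d div (q - 1)) \<le> real n powr c")
    \<comment> \<open>A large quotient makes \<open>delta q d\<close> at most
      \<open>1 / n powr c\<close>, so the claimed lower bound is at most 0.\<close>
    case False
    have "0 < n\<^sub>0" unfolding n\<^sub>0_def using q by (intro zero_less_power mult_pos_pos add_pos_pos) auto
    then have "n \<noteq> 0" using n(1) by linarith
    have "delta q d \<le> real q powr (- real (d div (q - 1)))" by (rule delta_le_powr[OF q])
    also have "\<dots> = 1 / real q ^ (d div (q - 1))" using q by (simp add: powr_minus powr_realpow divide_inverse)
    also have "\<dots> \<le> 1 / real n powr c" using False \<open>n \<noteq> 0\<close> q by (intro divide_left_mono mult_pos_pos) auto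
    finally show ?thesis using measure_nonneg[of "measure_pmf (pmf_of_set (balanced_multislice n))" "{b. mpoly_eval P b \<noteq> 0}"]
      by linarith
  next
    case True
    obtain m where m: "n = q * m" using n(2) by (elim dvdE)
    define \<Omega> where "\<Omega> = slice {..<n} (\<lambda>_ :: 'a. m)"
    define S where "S = {x \<in> \<Omega>. mpoly_eval P x \<noteq> 0}"
    have \<Omega>: "balanced_multislice n = \<Omega>"
      unfolding \<Omega>_def m assms[symmetric] by (rule balanced_multislice_eq_slice)
    have "finite \<Omega>" unfolding \<Omega>_def by (rule finite_slice) simp
    have "S \<noteq> {}" "\<Omega> \<noteq> {}" using nz by (auto simp: \<Omega> S_def)
    have "\<Omega> \<inter> {b. mpoly_eval P b \<noteq> 0} = S" by (auto simp: S_def)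
    then have "measure_pmf.prob (pmf_of_set (balanced_multislice n)) {b. mpoly_eval P b \<noteq> 0} = real (card S) / card \<Omega>"
      unfolding \<Omega> using \<open>finite \<Omega>\<close> \<open>\<Omega> \<noteq> {}\<close> by (simp add: measure_pmf_of_set)
    also have "\<dots> \<ge> delta q d - 1 / real n powr c"
      using slice_nonzero_probability_low_degree[of d "mpoly_eval P" m, unfolded assms, folded m, folded \<Omega>_def,
          folded S_def, folded c_def n\<^sub>0_def, OF pdeg_mono[OF pdeg_mpoly_eval P] \<open>S \<noteq> {}\<close> True n(1)] .
    finally show ?thesis .
  qed
  moreover have "c > 0" using q by (simp add: c_def)
  ultimately show ?thesis by blast
qed

end
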